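(* Let $(K,v)$ be a valued field with $\mathrm{char}\,Kv=p>0$ and let $\mathcal{E}=(L|K,v)$ be a Galois defect extension of prime degree $p$. Then: 1) For every generator $\sigma$ of $\mathrm{Gal}(L|K)$, the set $\Sigma_\sigma$ is a final segment of $vK^{>0}$, and it does not depend on the choice of the generator $\sigma$; denote it by $\Sigma_\mathcal{E}$. 2) For every $a\in L\setminus K$ and every generator $\sigma$ of $\mathrm{Gal}(L|K)$, $\Sigma_\mathcal{E}=-v(a-K)+v(\sigma a-a)$, and $I_\mathcal{E}=(\sigma a-a)I_{a-K}$, $H_\mathcal{E}=H_{a-K}$, $\mathcal{O}_\mathcal{E}=\mathcal{O}_{a-K}$, $\mathcal{M}_\mathcal{E}=\mathcal{M}_{a-K}$. 3) For every $a\in L\setminus K$, $H_\mathcal{E}=\mathcal{G}(v(a-K))=\mathcal{G}(-v(a-K))$.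
   Context: Notation: $vK$ value group, $vK^{>0}$ its positive elements, $\mathcal{O}_L$ valuation ring of $L$. A Galois defect extension of prime degree $p$ is a Galois extension $L|K$ of degree $p$ such that $v$ extends uniquely to $L$ and $vL=vK$, $Lv=Kv$. For $\sigma\in\mathrm{Gal}(L|K)$, $\sigma\neq\mathrm{id}$: $\Sigma_\sigma=\{v((\sigma b-b)/b)\mid b\in L^\times,\sigma b\neq b\}$. For $a\in L$ and $M\subseteq K$: $v(a-M)=\{v(a-c)\mid c\in M\}$; $-S=\{-\alpha\mid\alpha\in S\}$ and $\gamma+S=\{\gamma+\alpha\mid\alpha\in S\}$. For $S\subseteq vL$: $\mathcal{G}(S)=\{\gamma\in vL\mid S+\gamma=S\}$. For an $\mathcal{O}_L$-submodule $I\subseteq L$: $\mathcal{O}(I)=\{b\in L\mid bI\subseteq I\}$, a valuation ring containing $\mathcal{O}_L$ with maximal ideal $\{b\in L\mid bI\subsetneq I\}$; for a valuation ring $\mathcal{O}\supseteq\mathcal{O}_L$, $H(\mathcal{O})=v(\mathcal{O}^\times)$. Definitions: $I_\mathcal{E}=\{b\in L\mid vb\in\Sigma_\mathcal{E}\}\cup\{0\}$; $\mathcal{O}_\mathcal{E}=\mathcal{O}(I_\mathcal{E})$ with maximal ideal $\mathcal{M}_\mathcal{E}$; $H_\mathcal{E}=H(\mathcal{O}_\mathcal{E})$. For $a\in L\setminus K$: $I_{a-K}$ is the $\mathcal{O}_L$-module generated by $\{b\in L\mid\exists c\in K: vb\ge -v(a-c)\}$; $\mathcal{O}_{a-K}=\mathcal{O}(I_{a-K})$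 with maximal ideal $\mathcal{M}_{a-K}$; $H_{a-K}=H(\mathcal{O}_{a-K})$. *)

theory Defs
  imports "HOL-Algebra.Algebraic_Closure_Type" "HOL-Algebra.Generated_Groups" "HOL-Algebra.QuotRing"
begin

text \<open>
  The big field \<open>L\<close> is the universe of a type of class \<open>field\<close> and the ground field
  \<open>K\<close> is a subset of it. \<open>LL\<close> is \<open>L\<close> seen as an HOL-Algebra ring, so that
  \<open>subfield\<close>, \<open>ring.dimension\<close>, \<open>ring_iso\<close> etc. can be used.
\<close>

abbreviation LL :: "'l::field ring"
  where "LL \<equiv> ring_of_type_algebra"

subsection \<open>Valued fields\<close>

text \<open>
  Valuations are written additively. The value \<open>v 0 = \<infinity>\<close> is not represented: \<open>v 0\<close> is
  an unspecified element, and every definition below treats \<open>0\<close> separately. The type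
  \<open>'g\<close> is an arbitrary ordered abelian group containing the value group; \<open>v\<close>
  need not be onto.
\<close>

locale krull_valuation =
  fixes v :: "'l::field \<Rightarrow> 'g::linordered_ab_group_add"
  assumes val_mult: "\<lbrakk>x \<noteq> 0; y \<noteq> 0\<rbrakk> \<Longrightarrow> v (x * y) = v x + v y"
    and val_add: "\<lbrakk>x \<noteq> 0; y \<noteq> 0; x + y \<noteq> 0\<rbrakk> \<Longrightarrow> min (v x) (v y) \<le> v (x + y)"

text \<open>For a subfield \<open>F\<close> of \<open>L\<close>: the value group \<open>vF\<close> of the restriction of \<open>v\<close> to \<open>F\<close>.\<close>

definition value_group :: "('l::field \<Rightarrow> 'g::linordered_ab_group_add) \<Rightarrow> 'l set \<Rightarrow> 'g set"
  where "value_group v F = v ` (F - {0})"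

definition val_ring :: "('l::field \<Rightarrow> 'g::linordered_ab_group_add) \<Rightarrow> 'l set"
  where "val_ring v = {x. x = 0 \<or> 0 \<le> v x}"

definition val_ideal :: "('l::field \<Rightarrow> 'g::linordered_ab_group_add) \<Rightarrow> 'l set"
  where "val_ideal v = {x. x = 0 \<or> 0 < v x}"

text \<open>
  The residue field \<open>Fv\<close> of a subfield \<open>F\<close>, in the usual way regarded as a subfield of
  the residue field of \<open>L\<close>: it consists of the residue classes, modulo the maximal ideal
  of the valuation ring of \<open>L\<close>, of those elements of the valuation ring that lie in
  \<open>F\<close>. For \<open>F = UNIV\<close> this is \<open>Lv\<close>.
\<close>

definition residue_field ::
    "('l::field \<Rightarrow> 'g::linordered_ab_group_add) \<Rightarrow> 'l set \<Rightarrow> 'l set ring"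
  where "residue_field v F =
    (let V = LL\<lparr>carrier := val_ring v\<rparr>
     in (V Quot val_ideal v)\<lparr>carrier := (\<lambda>c. val_ideal v +>\<^bsub>V\<^esub> c) ` (val_ring v \<inter> F)\<rparr>)"

text \<open>The HOL-Algebra counterpart of \<open>CHAR\<close>; it is \<open>0\<close> if no positive multiple of one vanishes.\<close>

definition ring_char :: "('a, 'b) ring_scheme \<Rightarrow> nat"
  where "ring_char R = Gcd {n :: nat. [n] \<cdot>\<^bsub>R\<^esub> \<one>\<^bsub>R\<^esub> = \<zero>\<^bsub>R\<^esub>}"

definition valuation_subring :: "'l::field set \<Rightarrow> bool"
  where "valuation_subring A \<longleftrightarrow> subring A LL \<and> (\<forall>x. x \<noteq> 0 \<longrightarrow> x \<in> A \<or> inverse x \<in> A)"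

text \<open>
  Extensions of valuations are counted up to equivalence, that is, by their valuation rings;
  this is also what makes it possible to quantify over valuations with arbitrary value groups
  within the logic.
\<close>

definition unique_extension ::
    "('l::field \<Rightarrow> 'g::linordered_ab_group_add) \<Rightarrow> 'l set \<Rightarrow> bool"
  where "unique_extension v K \<longleftrightarrow>
    (\<forall>A. valuation_subring A \<and> A \<inter> K = val_ring v \<inter> K \<longrightarrow> A = val_ring v)"

subsection \<open>Galois defect extensions of prime degree\<close>

definition gal :: "'l::field set \<Rightarrow> ('l \<Rightarrow> 'l) monoid"
  where "gal K = \<lparr>carrier = {\<sigma> \<in> ring_iso LL LL. \<forall>x\<in>K. \<sigma> x = x}, monoid.mult = (\<circ>), one = id\<rparr>"

definition gal_generator :: "'l::field set \<Rightarrow> ('l \<Rightarrow> 'l) \<Rightarrow> bool"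
  where "gal_generator K \<sigma> \<longleftrightarrow>
    \<sigma> \<in> carrier (gal K) \<and> generate (gal K) {\<sigma>} = carrier (gal K)"

definition galois_extension :: "nat \<Rightarrow> 'l::field set \<Rightarrow> bool"
  where "galois_extension n K \<longleftrightarrow>
    subfield K LL \<and> ring.dimension LL n K UNIV \<and> {x. \<forall>\<sigma>\<in>carrier (gal K). \<sigma> x = x} = K"

definition galois_defect_extension ::
    "nat \<Rightarrow> 'l::field set \<Rightarrow> ('l \<Rightarrow> 'g::linordered_ab_group_add) \<Rightarrow> bool"
  where "galois_defect_extension p K v \<longleftrightarrow>
    Factorial_Ring.prime p \<and> galois_extension p K \<and> krull_valuation v \<and> unique_extension v K \<and>
    value_group v UNIV = value_group v K \<and> residue_field v UNIV = residue_field v K"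

subsection \<open>Sets of values and invariance groups\<close>

definition final_segment_of :: "'g::linorder set \<Rightarrow> 'g set \<Rightarrow> bool"
  where "final_segment_of S T \<longleftrightarrow> S \<subseteq> T \<and> (\<forall>\<alpha>\<in>S. \<forall>\<beta>\<in>T. \<alpha> \<le> \<beta> \<longrightarrow> \<beta> \<in> S)"

definition Sigma_set ::
    "('l::field \<Rightarrow> 'g::linordered_ab_group_add) \<Rightarrow> ('l \<Rightarrow> 'l) \<Rightarrow> 'g set"
  where "Sigma_set v \<sigma> = {v ((\<sigma> b - b) / b) | b. b \<noteq> 0 \<and> \<sigma> b \<noteq> b}"

definition Sigma_ext ::
    "('l::field \<Rightarrow> 'g::linordered_ab_group_add) \<Rightarrow> 'l set \<Rightarrow> 'g set"
  where "Sigma_ext v K = (THE S. \<exists>\<sigma>. gal_generator K \<sigma> \<and> S = Sigma_set v \<sigma>)"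

text \<open>Only used for \<open>a\<close> outside \<open>M\<close>, so that \<open>\<infinity>\<close> does not occur as a value.\<close>

definition val_diff ::
    "('l::field \<Rightarrow> 'g::linordered_ab_group_add) \<Rightarrow> 'l \<Rightarrow> 'l set \<Rightarrow> 'g set"
  where "val_diff v a M = (\<lambda>c. v (a - c)) ` M"

definition inv_group ::
    "('l::field \<Rightarrow> 'g::linordered_ab_group_add) \<Rightarrow> 'g set \<Rightarrow> 'g set"
  where "inv_group v S = {\<gamma> \<in> value_group v UNIV. (\<lambda>\<alpha>. \<alpha> + \<gamma>) ` S = S}"

subsection \<open>Submodules of L over its valuation ring and their multiplier rings\<close>

definition val_submodule ::
    "('l::field \<Rightarrow> 'g::linordered_ab_group_add) \<Rightarrow> 'l set \<Rightarrow> bool"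
  where "val_submodule v I \<longleftrightarrow>
    additive_subgroup I LL \<and> (\<forall>r\<in>val_ring v. \<forall>x\<in>I. r * x \<in> I)"

definition mult_ring :: "'l::field set \<Rightarrow> 'l set"
  where "mult_ring I = {b. (\<lambda>x. b * x) ` I \<subseteq> I}"

text \<open>The maximal ideal of \<^const>\<open>mult_ring\<close> \<open>I\<close>, for a nonzero submodule \<open>I\<close>.\<close>

definition mult_ideal :: "'l::field set \<Rightarrow> 'l set"
  where "mult_ideal I = {b. (\<lambda>x. b * x) ` I \<subset> I}"

text \<open>\<open>H(A) = v(A\<^sup>\<times>)\<close> for a valuation ring \<open>A\<close> of \<open>L\<close> containing that of \<open>v\<close>.\<close>

definition unit_values ::
    "('l::field \<Rightarrow> 'g::linordered_ab_group_add) \<Rightarrow> 'l set \<Rightarrow> 'g set"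
  where "unit_values v A = v ` Units (LL\<lparr>carrier := A\<rparr>)"

definition I_ext ::
    "('l::field \<Rightarrow> 'g::linordered_ab_group_add) \<Rightarrow> 'l set \<Rightarrow> 'l set"
  where "I_ext v K = {b. b \<noteq> 0 \<and> v b \<in> Sigma_ext v K} \<union> {0}"

definition O_ext ::
    "('l::field \<Rightarrow> 'g::linordered_ab_group_add) \<Rightarrow> 'l set \<Rightarrow> 'l set"
  where "O_ext v K = mult_ring (I_ext v K)"

definition M_ext ::
    "('l::field \<Rightarrow> 'g::linordered_ab_group_add) \<Rightarrow> 'l set \<Rightarrow> 'l set"
  where "M_ext v K = mult_ideal (I_ext v K)"

definition H_ext ::
    "('l::field \<Rightarrow> 'g::linordered_ab_group_add) \<Rightarrow> 'l set \<Rightarrow> 'g set"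
  where "H_ext v K = unit_values v (O_ext v K)"

definition I_diff ::
    "('l::field \<Rightarrow> 'g::linordered_ab_group_add) \<Rightarrow> 'l \<Rightarrow> 'l set \<Rightarrow> 'l set"
  where "I_diff v a K = val_submodule v hull {b. b = 0 \<or> (\<exists>c\<in>K. v b \<ge> - v (a - c))}"

definition O_diff ::
    "('l::field \<Rightarrow> 'g::linordered_ab_group_add) \<Rightarrow> 'l \<Rightarrow> 'l set \<Rightarrow> 'l set"
  where "O_diff v a K = mult_ring (I_diff v a K)"

definition M_diff ::
    "('l::field \<Rightarrow> 'g::linordered_ab_group_add) \<Rightarrow> 'l \<Rightarrow> 'l set \<Rightarrow> 'l set"
  where "M_diff v a K = mult_ideal (I_diff v a K)"

definition H_diff ::
    "('l::field \<Rightarrow> 'g::linordered_ab_group_add) \<Rightarrow> 'l \<Rightarrow> 'l set \<Rightarrow> 'g set"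
  where "H_diff v a K = unit_values v (O_diff v a K)"

end

theory Submission
  imports Defs
begin

text \<open>
  Comparing \<open>\<sigma>\<close> with \<open>\<sigma>\<^sup>k\<close> in both directions shows that \<open>v (\<sigma> b - b)\<close> does not depend on the
  generator. Everything else follows from \<open>\<Sigma>\<^sub>\<sigma> = v (\<sigma> a - a) - v (a - K)\<close>. The inclusion
  \<open>\<supseteq>\<close> comes from the elements \<open>b = a - c\<close>. For \<open>\<subseteq>\<close> write \<open>b = f(a)\<close> with
  \<open>f \<in> K[X]\<close> of degree less than \<open>p\<close> and let \<open>c \<in> K\<close> approach \<open>a\<close>. For every polynomial \<open>q\<close> the value
  \<open>v (q(c))\<close> is eventually \<open>\<beta> + h v (a - c)\<close> with a natural number \<open>h \<le> deg q\<close>, the slope of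
  \<open>q\<close>; slopes are multiplicative, and the minimal polynomial of \<open>a\<close> has slope \<open>p\<close>, because
  \<open>\<sigma>\<close> preserves \<open>v\<close>. If \<open>f\<close> has minimal degree among the polynomials over \<open>K\<close> of
  nonzero slope \<open>h\<close>, then the \<open>f\<close>-adic expansion of the minimal polynomial gives
  \<open>p = j h\<close> with \<open>j deg f \<le> p\<close>, and primality forces \<open>deg f = p\<close>. So polynomials of degree less than \<open>p\<close>
  have slope \<open>0\<close>: near \<open>a\<close>, the constant term of the Taylor expansion of \<open>f\<close> at \<open>a\<close> dominates, and
  evaluating that expansion at \<open>\<sigma> a\<close> bounds \<open>v (\<sigma> b - b)\<close> from below.
\<close>

subsection \<open>Subfields of a field given as a type\<close>

lemma LL_simps [simp]:
  "carrier LL = UNIV" "x \<otimes>\<^bsub>LL\<^esub> y = x * y" "x \<oplus>\<^bsub>LL\<^esub> y = x + y" "\<zero>\<^bsub>LL\<^esub> = 0" "\<one>\<^bsub>LL\<^esub> = 1"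
  by (simp_all add: ring_of_type_algebra_def)

lemma LL_field: "field (LL :: 'l::field ring)"
  by (rule field_from_type_algebra)

lemma LL_a_inv [simp]: "\<ominus>\<^bsub>LL\<^esub> x = - (x :: 'l::field)"
proof -
  interpret LL: field "LL :: 'l ring" by (rule LL_field)
  show ?thesis using LL.minus_equality[of "- x" x] by simp
qed

lemma LL_inv:
  assumes "x \<noteq> (0 :: 'l::field)"
  shows "inv\<^bsub>LL\<^esub> x = inverse x"
proof -
  interpret LL: field "LL :: 'l ring" by (rule LL_field)
  show ?thesis using assms LL.inv_unique'[of x "inverse x"] by simp
qed

lemma LL_pow [simp]: "x [^]\<^bsub>LL\<^esub> (n::nat) = (x :: 'l::field) ^ n"
proof -
  interpret LL: field "LL :: 'l ring" by (rule LL_field)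
  show ?thesis by (induction n) (simp_all add: mult.commute)
qed

lemma
  fixes K :: "'l::field set"
  assumes "subfield K LL"
  shows subfield_zero: "0 \<in> K" and subfield_one: "1 \<in> K"
    and subfield_add: "\<And>x y. \<lbrakk>x \<in> K; y \<in> K\<rbrakk> \<Longrightarrow> x + y \<in> K"
    and subfield_uminus: "\<And>x. x \<in> K \<Longrightarrow> - x \<in> K"
    and subfield_diff: "\<And>x y. \<lbrakk>x \<in> K; y \<in> K\<rbrakk> \<Longrightarrow> x - y \<in> K"
    and subfield_mult: "\<And>x y. \<lbrakk>x \<in> K; y \<in> K\<rbrakk> \<Longrightarrow> x * y \<in> K"
    and subfield_divide: "\<And>x y. \<lbrakk>x \<in> K; y \<in> K\<rbrakk> \<Longrightarrow> x / y \<in> K"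
proof -
  interpret LL: field "LL :: 'l ring" by (rule LL_field)
  note sr = subfieldE(1)[OF assms]
  show 0: "0 \<in> K" using subringE(2)[OF sr] by simp
  show "1 \<in> K" using subringE(3)[OF sr] by simp
  show add: "x + y \<in> K" if "x \<in> K" "y \<in> K" for x y using subringE(7)[OF sr that] by simp
  show uminus: "- x \<in> K" if "x \<in> K" for x using subringE(5)[OF sr that] by simp
  show "x - y \<in> K" if "x \<in> K" "y \<in> K" for x y using add[OF that(1) uminus[OF that(2)]] by simp
  show mult: "x * y \<in> K" if "x \<in> K" "y \<in> K" for x y using subringE(6)[OF sr that] by simp
  have inverse: "inverse x \<in> K" if "x \<in> K" for x
    using LL.subfield_m_inv(1)[OF assms, of x] that 0 LL_inv[of x] by (cases "x = 0") auto
  show "x / y \<in> K" if "x \<in> K" "y \<in> K" for x y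
    using mult[OF that(1) inverse[OF that(2)]] by (simp add: divide_inverse)
qed

lemma subring_LL_I:
  fixes F :: "'l::field set"
  assumes "1 \<in> F" "\<And>x y. \<lbrakk>x \<in> F; y \<in> F\<rbrakk> \<Longrightarrow> x + y \<in> F" "\<And>x. x \<in> F \<Longrightarrow> - x \<in> F"
    and "\<And>x y. \<lbrakk>x \<in> F; y \<in> F\<rbrakk> \<Longrightarrow> x * y \<in> F"
  shows "subring F LL"
proof -
  interpret LL: field "LL :: 'l ring" by (rule LL_field)
  show ?thesis by (rule LL.subringI) (use assms in auto)
qed

lemma subfield_LL_I:
  fixes F :: "'l::field set"
  assumes "1 \<in> F" "\<And>x y. \<lbrakk>x \<in> F; y \<in> F\<rbrakk> \<Longrightarrow> x + y \<in> F" "\<And>x. x \<in> F \<Longrightarrow> - x \<in> F"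
    and "\<And>x y. \<lbrakk>x \<in> F; y \<in> F\<rbrakk> \<Longrightarrow> x * y \<in> F" "\<And>x. x \<in> F \<Longrightarrow> inverse x \<in> F"
  shows "subfield F LL"
proof -
  interpret LL: field "LL :: 'l ring" by (rule LL_field)
  show ?thesis
    by (rule LL.subfieldI'[OF subring_LL_I[OF assms(1-4)]]) (use assms(5) in \<open>auto simp: LL_inv\<close>)
qed

text \<open>By the tower law the degrees of F over K and of L over F multiply to the prime p, so one
  of them is 1; a one-dimensional space containing 1 is spanned by it.\<close>

lemma no_intermediate_field:
  fixes K F :: "'l::field set"
  assumes K: "subfield K LL" and dim: "ring.dimension LL p K UNIV" and p: "Factorial_Ring.prime p"
    and F: "subfield F LL" and KF: "K \<subseteq> F"
  shows "F = K \<or> F = UNIV"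
proof -
  interpret LL: field "LL :: 'l ring" by (rule LL_field)
  have "subalgebra K F LL"
    by (rule subalgebra.intro, rule subring.axioms(1)[OF subfieldE(1)[OF F]], unfold_locales)
      (use KF subfield_mult[OF F] in auto)
  then have "LL.finite_dimension K F"
    using LL.subalbegra_incl_imp_finite_dimension[OF K LL.finite_dimensionI[OF dim]] by blast
  then obtain n where n: "LL.dimension n K F" by auto
  \<comment> \<open>A list that spans L over K also spans it over F, which makes L
    finite-dimensional over F.\<close>
  obtain Us where Us: "LL.Span K Us = UNIV"
    using LL.exists_base[OF K dim] by blast
  have "LL.Span K Us \<subseteq> LL.Span F Us"
    using KF LL.Span_eq_combine_set[OF K, of Us] LL.Span_eq_combine_set[OF F, of Us]
    by (simp del: LL.Span.simps) (blast intro: subset_trans)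
  then have "LL.Span F Us = UNIV" using Us by blast
  then have "LL.finite_dimension F UNIV"
    using LL.Span_finite_dimension[OF F, of Us] by simp
  then obtain m where m: "LL.dimension m F UNIV" by auto
  have "n * m = p"
    using LL.dimension_is_inj[OF K LL.telescopic_base[OF K F n m] dim] .
  then consider "n = 1" | "m = 1"
    using p by (metis prime_product)
  then show ?thesis
  proof cases
    case 1
    have "set [1 :: 'l] \<subseteq> F" using subfield_one[OF F] by simp
    moreover have "LL.independent K [1 :: 'l]"
      using LL.independent.li_Cons[of "1 :: 'l" K "[]"] by simp
    moreover have "LL.Span K [1 :: 'l] = K"
      using LL.line_extension_mem_iff[of _ K "1::'l" "{0}"] by auto
    ultimately show ?thesis
      using LL.independent_length_eq_dimension[OF K n, of "[1]"] 1 by auto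
  next
    case 2
    have "LL.independent F [1 :: 'l]"
      using LL.independent.li_Cons[of "1 :: 'l" F "[]"] by simp
    moreover have "LL.Span F [1 :: 'l] = F"
      using LL.line_extension_mem_iff[of _ F "1::'l" "{0}"] by auto
    ultimately show ?thesis
      using LL.independent_length_eq_dimension[OF F m, of "[1]"] 2 by auto
  qed
qed

text \<open>Type-level polynomials with coefficients in K, so that \<open>degree\<close>,
  \<open>pcompose\<close>, \<open>div\<close> and \<open>mod\<close> are available while evaluation
  points range over all of L.\<close>

definition polys_over :: "'l::field set \<Rightarrow> 'l poly set"
  where "polys_over K = {f. \<forall>i. coeff f i \<in> K}"

text \<open>Translates coordinates with respect to the basis of powers of a into polynomial
  evaluation. \<open>exp_base\<close> lists the highest power first, hence the
  \<open>rev\<close>.\<close>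

lemma combine_exp_base:
  fixes a :: "'l::field"
  assumes "length ks = n"
  shows "ring.combine LL ks (ring.exp_base LL a n) = poly (Poly (rev ks)) a"
proof -
  interpret LL: field "LL :: 'l ring" by (rule LL_field)
  have append: "poly (Poly (xs @ [x])) a = poly (Poly xs) a + x * a ^ length xs" for xs x
    by (induction xs) (simp_all add: algebra_simps)
  show ?thesis using assms
  proof (induction ks arbitrary: n)
    case (Cons k ks)
    have "LL.exp_base a (Suc (length ks)) = a ^ length ks # LL.exp_base a (length ks)"
      by (simp add: LL.exp_base_def)
    then show ?case using Cons append[of "rev ks" k] by (auto simp: algebra_simps)
  qed (simp add: LL.exp_base_def)
qed

text \<open>K(a) is an intermediate field different from K, hence equal to L. So the powers of a
  with exponent below p form a K-basis: spanning gives the first claim, independence the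
  second.\<close>

lemma
  fixes K :: "'l::field set"
  assumes K: "subfield K LL" and dim: "ring.dimension LL p K UNIV" and p: "Factorial_Ring.prime p"
    and a: "a \<notin> K"
  shows primitive_element: "\<exists>f\<in>polys_over K. degree f < p \<and> b = poly f a"
    and primitive_independent: "\<lbrakk>f \<in> polys_over K; f \<noteq> 0; degree f < p\<rbrakk> \<Longrightarrow> poly f a \<noteq> 0"
proof -
  interpret LL: field "LL :: 'l ring" by (rule LL_field)
  have alg: "(LL.algebraic over K) a"
    using LL.finite_dimension_imp_algebraic[OF K LL.carrier_is_subring, of a]
      LL.finite_dimensionI[OF dim] by simp
  have "subfield (LL.simple_extension K a) LL"
    using LL.simple_extension_is_subfield[OF K, of a] alg by simp
  moreover have "K \<subseteq> LL.simple_extension K a" "a \<in> LL.simple_extension K a"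
    using LL.simple_extension_incl[of K a] LL.simple_extension_mem[OF subfieldE(1)[OF K], of a]
    by auto
  ultimately have UNIV: "LL.simple_extension K a = UNIV"
    using no_intermediate_field[OF K dim p] a by blast
  define d where "d = Polynomials.degree (LL.Irr K a)"
  have "LL.dimension d K UNIV"
    using LL.dimension_simple_extension[OF K _ alg] UNIV unfolding d_def by simp
  then have d: "d = p" by (rule LL.dimension_is_inj[OF K _ dim])
  have indep: "LL.independent K (LL.exp_base a p)"
    using LL.exp_base_independent[OF K _ alg] d unfolding d_def by simp
  have "LL.Span K (LL.exp_base a p) = UNIV"
    using LL.Span_exp_base[OF K _ alg] d UNIV unfolding d_def by simp
  then have "b \<in> LL.Span K (LL.exp_base a p)" by simp
  then obtain ks where ks: "set ks \<subseteq> K" "length ks = p" "b = LL.combine ks (LL.exp_base a p)"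
    using LL.Span_mem_iff_length_version[OF K, of "LL.exp_base a p" b]
    by (auto simp: LL.exp_base_def)
  have "coeff (Poly (rev ks)) i \<in> K" for i
    using ks(1) subfield_zero[OF K] nth_mem[of i "rev ks"]
    by (auto simp: coeff_Poly_eq nth_default_def simp del: nth_mem)
  moreover have "degree (Poly (rev ks)) < p"
  proof -
    have "degree (Poly (rev ks)) \<le> p - 1"
      using ks(2) prime_gt_0_nat[OF p] by (intro degree_le) (auto simp: nth_default_def)
    then show ?thesis using prime_gt_0_nat[OF p] by simp
  qed
  ultimately show "\<exists>f\<in>polys_over K. degree f < p \<and> b = poly f a"
    using combine_exp_base[OF ks(2), of a] ks(3)
    by (intro bexI[of _ "Poly (rev ks)"]) (auto simp: polys_over_def)
  show "poly f a \<noteq> 0" if f: "f \<in> polys_over K" "f \<noteq> 0" "degree f < p"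
  proof
    assume 0: "poly f a = 0"
    \<comment> \<open>The coefficients are padded with zeros to length p, so that they are
      coordinates for the whole basis.\<close>
    define ks where "ks = rev (map (coeff f) [0..<p])"
    have Poly: "Poly (rev ks) = f"
      using f(3) coeff_eq_0[of f]
      by (intro poly_eqI) (auto simp: ks_def nth_default_def)
    have "LL.combine ks (LL.exp_base a p) = 0"
      using combine_exp_base[of ks p a] Poly 0 by (simp add: ks_def)
    moreover have "set ks \<subseteq> K" using f(1) by (auto simp: ks_def polys_over_def)
    ultimately have "set (take (length (LL.exp_base a p)) ks) \<subseteq> {0}"
      using LL.independent_imp_trivial_combine[OF K indep, of ks] by simp
    then have "set ks \<subseteq> {0}" by (simp add: LL.exp_base_def ks_def)
    then have "coeff f i = 0" for i
      using f(3) coeff_eq_0[of f i] by (cases "i < p") (auto simp: ks_def image_subset_iff)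
    then show False using f(2) by (simp add: poly_eq_iff)
  qed
qed

section \<open>Closure properties of the polynomials over K\<close>

lemma polys_over_simps [simp]:
  assumes "subfield K LL"
  shows "0 \<in> polys_over K" "pCons c f \<in> polys_over K \<longleftrightarrow> c \<in> K \<and> f \<in> polys_over K"
  using subfield_zero[OF assms] by (auto simp: polys_over_def coeff_pCons split: nat.splits)

lemma polys_over_diff:
  "\<lbrakk>subfield K LL; f \<in> polys_over K; g \<in> polys_over K\<rbrakk> \<Longrightarrow> f - g \<in> polys_over K"
  by (simp add: polys_over_def subfield_diff)

lemma polys_over_smult: "\<lbrakk>subfield K LL; c \<in> K; f \<in> polys_over K\<rbrakk> \<Longrightarrow> smult c f \<in> polys_over K"
  by (simp add: polys_over_def subfield_mult)

lemma polys_over_monom: "\<lbrakk>subfield K LL; c \<in> K\<rbrakk> \<Longrightarrow> monom c n \<in> polys_over K"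
  by (simp add: polys_over_def subfield_zero)

text \<open>Induction along the coefficients of q: each step of long division divides only by the
  leading coefficient of f, which lies in K.\<close>

lemma polys_over_div_mod:
  assumes K: "subfield K LL" and f: "f \<in> polys_over K" and q: "q \<in> polys_over K"
  shows "q div f \<in> polys_over K" "q mod f \<in> polys_over K"
proof -
  have "q div f \<in> polys_over K \<and> q mod f \<in> polys_over K"
    using q
  proof (induction q)
    case 0
    then show ?case using K by simp
  next
    case (pCons c q)
    then have IH: "q div f \<in> polys_over K" "q mod f \<in> polys_over K" and c: "c \<in> K"
      using K by simp_all
    let ?k = "coeff (pCons c (q mod f)) (degree f) / lead_coeff f"
    have *: "pCons c (q mod f) \<in> polys_over K" using K IH c by simp
    then have k: "?k \<in> K" using f by (simp add: subfield_divide[OF K] polys_over_def)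
    show ?case
      using IH c k * f K
      by (auto simp: div_pCons_eq mod_pCons polys_over_diff[OF K] polys_over_smult[OF K])
  qed
  then show "q div f \<in> polys_over K" "q mod f \<in> polys_over K" by auto
qed

subsection \<open>Cyclic extensions of prime degree\<close>

locale galois_prime =
  fixes K :: "'l::field set" and p :: nat
  assumes galois: "galois_extension p K" and prime_p: "Factorial_Ring.prime p"
begin

lemma subfield_K: "subfield K LL" and dimension_K: "ring.dimension LL p K UNIV"
  and fixed_gal: "(\<forall>\<sigma>\<in>carrier (gal K). \<sigma> x = x) \<longleftrightarrow> x \<in> K"
  using galois by (auto simp: galois_extension_def)

lemmas K_zero = subfield_zero[OF subfield_K]
  and K_one = subfield_one[OF subfield_K]
  and K_add = subfield_add[OF subfield_K]
  and K_uminus = subfield_uminus[OF subfield_K]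
  and K_mult = subfield_mult[OF subfield_K]
  and K_divide = subfield_divide[OF subfield_K]

lemma p_pos: "0 < p" and p_gt_1: "1 < p"
  using prime_gt_0_nat[OF prime_p] prime_gt_1_nat[OF prime_p] by simp_all

lemma K_proper: "\<exists>a. a \<notin> K"
proof (rule ccontr)
  interpret LL: field "LL :: 'l ring" by (rule LL_field)
  assume "\<nexists>a. a \<notin> K"
  then have "K = UNIV" by auto
  then have "LL.dimension 1 K UNIV" using LL.dimension_one[OF subfield_K] by simp
  then have "p = 1" by (rule LL.dimension_is_inj[OF subfield_K dimension_K])
  then show False using p_gt_1 by simp
qed

lemma gal_iff:
  "\<sigma> \<in> carrier (gal K) \<longleftrightarrow> (\<forall>x y. \<sigma> (x + y) = \<sigma> x + \<sigma> y) \<and> (\<forall>x y. \<sigma> (x * y) = \<sigma> x * \<sigma> y) \<and>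
     \<sigma> 1 = 1 \<and> bij \<sigma> \<and> (\<forall>x\<in>K. \<sigma> x = x)"
  by (auto simp: gal_def ring_iso_def ring_hom_def)

lemma gal_group: "group (gal K)"
proof (rule groupI)
  fix \<sigma> assume s: "\<sigma> \<in> carrier (gal K)"
  define \<tau> where "\<tau> = inv_into UNIV \<sigma>"
  have bij: "bij \<sigma>" using s by (simp add: gal_iff)
  have eq: "\<tau> (\<sigma> x) = x" "\<sigma> (\<tau> x) = x" for x
    unfolding \<tau>_def using bij by (simp_all add: bij_is_inj bij_is_surj surj_f_inv_f)
  have "\<tau> \<in> carrier (gal K)"
    unfolding gal_iff
  proof (intro conjI allI ballI)
    fix x y
    show "\<tau> (x + y) = \<tau> x + \<tau> y" "\<tau> (x * y) = \<tau> x * \<tau> y"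
      using s eq by (metis gal_iff)+
    show "\<tau> 1 = 1" using s eq by (metis gal_iff)
    show "bij \<tau>" unfolding \<tau>_def using bij by (rule bij_imp_bij_inv)
    show "\<tau> x = x" if "x \<in> K" using s eq that by (metis gal_iff)
  qed
  moreover have "\<tau> \<otimes>\<^bsub>gal K\<^esub> \<sigma> = \<one>\<^bsub>gal K\<^esub>"
    using eq by (auto simp: gal_def)
  ultimately show "\<exists>\<tau>\<in>carrier (gal K). \<tau> \<otimes>\<^bsub>gal K\<^esub> \<sigma> = \<one>\<^bsub>gal K\<^esub>" by blast
qed (auto simp: gal_iff, auto simp: gal_def intro: bij_comp)

lemma gal_generator_ne_id:
  assumes "gal_generator K \<sigma>"
  shows "\<sigma> \<noteq> id"
proof
  interpret G: group "gal K" by (rule gal_group)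
  assume "\<sigma> = id"
  then have "generate (gal K) {id} = carrier (gal K)"
    using assms by (simp add: gal_generator_def)
  moreover have "\<one>\<^bsub>gal K\<^esub> = id" by (simp add: gal_def)
  ultimately have "carrier (gal K) = {id}"
    using G.generate_one by simp
  then show False using fixed_gal K_proper by auto
qed

end

text \<open>Only \<sigma> \<noteq> id is assumed; that \<sigma> generates the group is derived in
  \<open>gal_generator_sigma\<close>, which also supplies the existence of a generator.\<close>

locale galois_prime_auto = galois_prime +
  fixes \<sigma> :: "'l::field \<Rightarrow> 'l"
  assumes sigma: "\<sigma> \<in> carrier (gal K)" and sigma_ne_id: "\<sigma> \<noteq> id"
begin

lemma sigma_add [simp]: "\<sigma> (x + y) = \<sigma> x + \<sigma> y"
  and sigma_mult [simp]: "\<sigma> (x * y) = \<sigma> x * \<sigma> y"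
  and sigma_one [simp]: "\<sigma> 1 = 1"
  and sigma_bij: "bij \<sigma>"
  and sigma_K: "x \<in> K \<Longrightarrow> \<sigma> x = x"
  using sigma by (simp_all add: gal_iff)

lemma sigma_zero [simp]: "\<sigma> 0 = 0"
  using sigma_K K_zero by blast

lemma sigma_eq_iff [simp]: "\<sigma> x = \<sigma> y \<longleftrightarrow> x = y"
  using sigma_bij by (auto simp: bij_def inj_def)

lemma sigma_eq_0_iff [simp]: "\<sigma> x = 0 \<longleftrightarrow> x = 0"
  using sigma_eq_iff[of x 0] by (simp del: sigma_eq_iff)

lemma sigma_uminus [simp]: "\<sigma> (- x) = - \<sigma> x"
  using sigma_add[of x "- x"] by (simp del: sigma_add add: eq_neg_iff_add_eq_0 add.commute)

lemma sigma_diff [simp]: "\<sigma> (x - y) = \<sigma> x - \<sigma> y"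
  using sigma_add[of x "- y"] by (simp del: sigma_add)

lemma sigma_inverse [simp]: "\<sigma> (inverse x) = inverse (\<sigma> x)"
  using sigma_mult[of x "inverse x"] by (cases "x = 0") (auto simp: field_simps simp del: sigma_mult)

lemma sigma_divide [simp]: "\<sigma> (x / y) = \<sigma> x / \<sigma> y"
  by (simp add: divide_inverse)

lemma sigma_sum: "\<sigma> (sum f A) = (\<Sum>x\<in>A. \<sigma> (f x))"
  by (induction A rule: infinite_finite_induct) simp_all

text \<open>The fixed field of \<sigma> is an intermediate field other than L, hence equal to
  K.\<close>

lemma sigma_eq_self_iff: "\<sigma> x = x \<longleftrightarrow> x \<in> K"
proof -
  have "subfield {x. \<sigma> x = x} LL"
    by (rule subfield_LL_I) auto
  moreover have "{x. \<sigma> x = x} \<noteq> UNIV" using sigma_ne_id by (auto simp: set_eq_iff)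
  ultimately have "{x. \<sigma> x = x} = K"
    using no_intermediate_field[OF subfield_K dimension_K prime_p] sigma_K by blast
  then show ?thesis by blast
qed

lemma sigma_poly: "f \<in> polys_over K \<Longrightarrow> \<sigma> (poly f x) = poly f (\<sigma> x)"
  by (induction f) (simp_all add: subfield_K sigma_K)

lemma map_poly_sigma_mult: "map_poly \<sigma> (f * g) = map_poly \<sigma> f * map_poly \<sigma> g"
  by (rule poly_eqI) (simp add: coeff_map_poly coeff_mult sigma_sum)

lemma map_poly_sigma_prod: "map_poly \<sigma> (prod f A) = (\<Prod>x\<in>A. map_poly \<sigma> (f x))"
  by (induction A rule: infinite_finite_induct) (simp_all add: map_poly_sigma_mult)

section \<open>Orbits of \<sigma> and the minimal polynomial of an element\<close>

lemma sigma_funpow: "\<sigma> ^^ i \<in> carrier (gal K)"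
  using sigma by (induction i) (auto simp: gal_iff intro: bij_comp)

lemma sigma_funpow_eq_iff: "(\<sigma> ^^ i) x = (\<sigma> ^^ i) y \<longleftrightarrow> x = y"
  using sigma_funpow[of i] by (simp add: gal_iff bij_is_inj inj_eq)

lemma orbit_inj_on:
  assumes a: "(\<sigma> ^^ k) a = a" and k: "0 < k" "\<And>j. \<lbrakk>0 < j; j < k\<rbrakk> \<Longrightarrow> (\<sigma> ^^ j) a \<noteq> a"
  shows "inj_on (\<lambda>i. (\<sigma> ^^ i) a) {..<k}"
proof (rule linorder_inj_onI)
  fix i j assume ij: "i < j" "i \<in> {..<k}" "j \<in> {..<k}"
  show "(\<sigma> ^^ i) a \<noteq> (\<sigma> ^^ j) a"
  proof
    assume "(\<sigma> ^^ i) a = (\<sigma> ^^ j) a"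
    also have "j = i + (j - i)" using ij by simp
    also have "(\<sigma> ^^ (i + (j - i))) a = (\<sigma> ^^ i) ((\<sigma> ^^ (j - i)) a)"
      by (simp add: funpow_add del: add_diff_inverse_nat)
    finally have "(\<sigma> ^^ (j - i)) a = a"
      by (simp add: sigma_funpow_eq_iff)
    then show False using k(2)[of "j - i"] ij by (simp add: less_imp_diff_less)
  qed
qed auto

text \<open>\<sigma> permutes the roots cyclically, so it fixes the product and therefore its
  coefficients.\<close>

lemma orbit_poly:
  assumes a: "(\<sigma> ^^ k) a = a" and k: "0 < k"
  shows "(\<Prod>i<k. [:- (\<sigma> ^^ i) a, 1:]) \<in> polys_over K"
proof -
  let ?M = "\<Prod>i<k. [:- (\<sigma> ^^ i) a, 1:]"
  obtain l where l: "k = Suc l" using k by (cases k) auto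
  have "map_poly \<sigma> ?M = (\<Prod>i<k. [:- (\<sigma> ^^ Suc i) a, 1:])"
    by (simp add: map_poly_sigma_prod map_poly_pCons)
  also have "\<dots> = [:- (\<sigma> ^^ k) a, 1:] * (\<Prod>i<l. [:- (\<sigma> ^^ Suc i) a, 1:])"
    unfolding l by (simp only: lessThan_Suc prod.insert finite_lessThan) simp
  also have "\<dots> = [:- (\<sigma> ^^ 0) a, 1:] * (\<Prod>i<l. [:- (\<sigma> ^^ Suc i) a, 1:])"
    using a by simp
  also have "\<dots> = ?M"
    unfolding l by (subst prod.lessThan_Suc_shift) simp
  finally have "map_poly \<sigma> ?M = ?M" .
  then have "\<sigma> (coeff ?M i) = coeff ?M i" for i
    by (metis coeff_map_poly sigma_zero)
  then show ?thesis by (simp add: polys_over_def sigma_eq_self_iff)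
qed

text \<open>Let k be the period of a under \<sigma>. The k distinct conjugates are roots of a
  nonzero polynomial over K of degree at most p, so k \<le> p. The orbit polynomial has degree k and
  vanishes at a, so independence of the powers of a gives p \<le> k.\<close>

lemma
  assumes a: "a \<notin> K"
  shows minimal_polynomial: "(\<Prod>i<p. [:- (\<sigma> ^^ i) a, 1:]) \<in> polys_over K"
    and sigma_funpow_p_self: "(\<sigma> ^^ p) a = a"
proof -
  obtain g where g: "g \<in> polys_over K" "degree g < p" "a ^ p = poly g a"
    using primitive_element[OF subfield_K dimension_K prime_p a] by blast
  \<comment> \<open>The relation expressing a^p by lower powers, read as a polynomial; \<sigma> maps
    its roots to roots.\<close>
  define m where "m = monom 1 p - g"
  have m_K: "m \<in> polys_over K"
    unfolding m_def by (intro polys_over_diff polys_over_monom subfield_K K_one g(1))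
  have "coeff m p = 1" using g(2) by (simp add: m_def coeff_eq_0)
  then have m0: "m \<noteq> 0" by auto
  have deg_m: "degree m \<le> p"
    unfolding m_def by (rule degree_diff_le) (use g(2) in \<open>simp_all add: degree_monom_le\<close>)
  have root: "poly m ((\<sigma> ^^ i) a) = 0" for i
  proof (induction i)
    case 0
    then show ?case using g(3) by (simp add: m_def poly_monom)
  next
    case (Suc i)
    then show ?case using sigma_poly[OF m_K, of "(\<sigma> ^^ i) a"] by simp
  qed
  have fin: "finite {x. poly m x = 0}" using m0 by (rule poly_roots_finite)
  have "\<not> inj_on (\<lambda>i. (\<sigma> ^^ i) a) (UNIV :: nat set)"
    using root finite_subset[OF _ fin, of "range (\<lambda>i. (\<sigma> ^^ i) a)"] finite_imageD by blast
  then have ex: "\<exists>k>0. (\<sigma> ^^ k) a = a"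
  proof -
    assume "\<not> inj (\<lambda>i. (\<sigma> ^^ i) a)"
    then obtain i j where ij: "i < j" "(\<sigma> ^^ i) a = (\<sigma> ^^ j) a"
      unfolding inj_def by (metis linorder_neqE_nat)
    have "(\<sigma> ^^ j) a = (\<sigma> ^^ i) ((\<sigma> ^^ (j - i)) a)"
      using ij(1) by (metis comp_apply funpow_add le_add_diff_inverse less_imp_le)
    then have "(\<sigma> ^^ (j - i)) a = a"
      using ij(2) by (simp add: sigma_funpow_eq_iff)
    then show ?thesis using ij(1) by (intro exI[of _ "j - i"]) simp
  qed
  define k where "k = (LEAST k. 0 < k \<and> (\<sigma> ^^ k) a = a)"
  have k: "0 < k" "(\<sigma> ^^ k) a = a"
    using LeastI_ex[OF ex] by (auto simp: k_def)
  have "(\<sigma> ^^ j) a \<noteq> a" if "0 < j" "j < k" for j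
    using that not_less_Least[of j "\<lambda>k. 0 < k \<and> (\<sigma> ^^ k) a = a"] by (auto simp: k_def)
  then have inj: "inj_on (\<lambda>i. (\<sigma> ^^ i) a) {..<k}"
    using orbit_inj_on k by blast
  let ?M = "\<Prod>i<k. [:- (\<sigma> ^^ i) a, 1:]"
  have M: "?M \<in> polys_over K" using orbit_poly k by blast
  have "k \<le> p"
  proof -
    have "k = card ((\<lambda>i. (\<sigma> ^^ i) a) ` {..<k})" using inj by (simp add: card_image)
    also have "\<dots> \<le> card {x. poly m x = 0}"
      by (rule card_mono[OF fin]) (use root in auto)
    also have "\<dots> \<le> degree m" using m0 by (rule card_poly_roots_bound)
    also have "\<dots> \<le> p" by (rule deg_m)
    finally show ?thesis .
  qed
  moreover have "p \<le> k"
  proof (rule ccontr)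
    assume "\<not> p \<le> k"
    moreover have "degree ?M = k" by (subst degree_prod_eq_sum_degree) auto
    moreover have "poly ?M a = 0"
      using k(1) by (auto simp: poly_prod intro!: prod_zero bexI[of _ 0])
    moreover have "?M \<noteq> 0" by simp
    ultimately show False
      using primitive_independent[OF subfield_K dimension_K prime_p a M] by simp
  qed
  ultimately have "k = p" by simp
  then show "(\<Prod>i<p. [:- (\<sigma> ^^ i) a, 1:]) \<in> polys_over K" "(\<sigma> ^^ p) a = a"
    using M k by simp_all
qed

lemma sigma_funpow_p: "(\<sigma> ^^ p) x = x"
  using sigma_funpow_p_self[of x] sigma_funpow[of p] by (cases "x \<in> K") (auto simp: gal_iff)

text \<open>\<tau> sends a to a root of its orbit polynomial, that is, to a conjugate \<sigma>^i a;
  an automorphism over K is determined by its value at a.\<close>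

lemma gal_eq_funpow:
  assumes t: "\<tau> \<in> carrier (gal K)"
  shows "\<exists>i<p. \<tau> = \<sigma> ^^ i"
proof -
  obtain a where a: "a \<notin> K" using K_proper by blast
  have hom: "\<rho> (poly f x) = poly f (\<rho> x)" if "\<rho> \<in> carrier (gal K)" "f \<in> polys_over K" for \<rho> f x
    using that K_zero by (induction f) (auto simp: subfield_K gal_iff)
  let ?M = "\<Prod>i<p. [:- (\<sigma> ^^ i) a, 1:]"
  have "poly ?M (\<tau> a) = \<tau> (poly ?M a)" using hom[OF t minimal_polynomial[OF a]] by simp
  also have "poly ?M a = 0"
    using p_pos by (auto simp: poly_prod intro!: prod_zero bexI[of _ 0])
  also have "\<tau> 0 = 0" using t K_zero by (auto simp: gal_iff)
  finally obtain i where i: "i < p" "\<tau> a = (\<sigma> ^^ i) a"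
    by (auto simp: poly_prod)
  have "\<tau> b = (\<sigma> ^^ i) b" for b
  proof -
    obtain f where "f \<in> polys_over K" "b = poly f a"
      using primitive_element[OF subfield_K dimension_K prime_p a] by blast
    then show ?thesis using hom[OF t] hom[OF sigma_funpow] i(2) by simp
  qed
  then show ?thesis using i(1) by blast
qed

lemma gal_generator_sigma: "gal_generator K \<sigma>"
proof -
  interpret G: group "gal K" by (rule gal_group)
  have "\<sigma> ^^ i \<in> generate (gal K) {\<sigma>}" for i
  proof (induction i)
    case 0
    have "\<one>\<^bsub>gal K\<^esub> = id" by (simp add: gal_def)
    then show ?case using generate.one[of "gal K" "{\<sigma>}"] by (simp add: id_def)
  next
    case (Suc i)
    have "\<sigma> \<otimes>\<^bsub>gal K\<^esub> \<sigma> ^^ i = \<sigma> ^^ Suc i" by (simp add: gal_def)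
    then show ?case
      using generate.eng[OF generate.incl[of \<sigma> "{\<sigma>}" "gal K"] Suc] by (simp add: comp_def)
  qed
  then have "carrier (gal K) \<subseteq> generate (gal K) {\<sigma>}" using gal_eq_funpow by blast
  then show ?thesis
    using G.generate_incl[of "{\<sigma>}"] sigma by (auto simp: gal_generator_def)
qed

end

subsection \<open>Krull valuations\<close>

context krull_valuation
begin

text \<open>\<open>vge\<close> and \<open>vgt\<close> are comparisons with v x in which 0 has
  infinite value, so that sums can be estimated without separating the case of a zero sum.\<close>

definition vge :: "'g \<Rightarrow> 'l \<Rightarrow> bool"
  where "vge \<gamma> x \<longleftrightarrow> x = 0 \<or> \<gamma> \<le> v x"

definition vgt :: "'g \<Rightarrow> 'l \<Rightarrow> bool"
  where "vgt \<gamma> x \<longleftrightarrow> x = 0 \<or> \<gamma> < v x"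

lemma val_one [simp]: "v 1 = 0"
  using val_mult[of 1 1] by simp

lemma val_minus_one: "v (- 1) = 0"
  using val_mult[of "- 1" "- 1"] by (simp add: double_zero_sym)

lemma val_uminus [simp]: "v (- x) = v x"
  using val_mult[of "- 1" x] val_minus_one by (cases "x = 0") auto

lemma val_minus_commute: "v (x - y) = v (y - x)"
  using val_uminus[of "x - y"] by simp

lemma val_inverse: "x \<noteq> 0 \<Longrightarrow> v (inverse x) = - v x"
  using val_mult[of x "inverse x"] by (simp add: eq_neg_iff_add_eq_0 add.commute)

lemma val_divide: "\<lbrakk>x \<noteq> 0; y \<noteq> 0\<rbrakk> \<Longrightarrow> v (x / y) = v x - v y"
  using val_mult[of x "inverse y"] val_inverse by (simp add: divide_inverse)

lemma val_power_strict_mono: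
  "\<lbrakk>x \<noteq> 0; y \<noteq> 0; v x < v y; 0 < n\<rbrakk> \<Longrightarrow> v (x ^ n) < v (y ^ n)"
proof (induction n)
  case (Suc n)
  then show ?case by (cases "n = 0") (auto simp: val_mult add_strict_mono)
qed simp

lemma val_power_mono: "\<lbrakk>x \<noteq> 0; y \<noteq> 0; v x \<le> v y\<rbrakk> \<Longrightarrow> v (x ^ n) \<le> v (y ^ n)"
  by (induction n) (auto simp: val_mult add_mono)

lemma val_le_val_power:
  assumes "x \<noteq> 0" "0 \<le> v x" "0 < n"
  shows "v x \<le> v (x ^ n)"
proof -
  obtain m where m: "n = Suc m" using assms(3) by (cases n) auto
  have "v (1 ^ m) \<le> v (x ^ m)" using val_power_mono[of 1 x m] assms by simp
  then show ?thesis using assms(1) by (simp add: m val_mult)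
qed

lemma vge_zero [simp]: "vge \<gamma> 0" and vgt_zero [simp]: "vgt \<gamma> 0"
  by (simp_all add: vge_def vgt_def)

lemma vge_add: "\<lbrakk>vge \<gamma> x; vge \<gamma> y\<rbrakk> \<Longrightarrow> vge \<gamma> (x + y)"
  using val_add[of x y] by (cases "x = 0 \<or> y = 0 \<or> x + y = 0") (auto simp: vge_def min_le_iff_disj)

lemma vgt_add: "\<lbrakk>vgt \<gamma> x; vgt \<gamma> y\<rbrakk> \<Longrightarrow> vgt \<gamma> (x + y)"
  using val_add[of x y] by (cases "x = 0 \<or> y = 0 \<or> x + y = 0") (auto simp: vgt_def min_le_iff_disj)

lemma vge_uminus [simp]: "vge \<gamma> (- x) \<longleftrightarrow> vge \<gamma> x"
  by (simp add: vge_def)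

lemma vgt_uminus [simp]: "vgt \<gamma> (- x) \<longleftrightarrow> vgt \<gamma> x"
  by (simp add: vgt_def)

lemma vge_sum: "(\<And>i. i \<in> A \<Longrightarrow> vge \<gamma> (f i)) \<Longrightarrow> vge \<gamma> (sum f A)"
  by (induction A rule: infinite_finite_induct) (simp_all add: vge_add)

lemma vgt_sum: "(\<And>i. i \<in> A \<Longrightarrow> vgt \<gamma> (f i)) \<Longrightarrow> vgt \<gamma> (sum f A)"
  by (induction A rule: infinite_finite_induct) (simp_all add: vgt_add)

text \<open>The ultrametric inequality for x + y gives one estimate; applied to x = (x + y) - y it
  gives the other.\<close>

lemma
  assumes "x \<noteq> 0" "vgt (v x) y"
  shows add_dominant_ne_0: "x + y \<noteq> 0" and val_add_dominant: "v (x + y) = v x"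
proof -
  show ne: "x + y \<noteq> 0"
  proof
    assume "x + y = 0"
    then have "y = - x" by (simp add: eq_neg_iff_add_eq_0 add.commute)
    then show False using assms by (simp add: vgt_def)
  qed
  show "v (x + y) = v x"
  proof (cases "y = 0")
    case False
    then have "v x < v y" using assms(2) by (simp add: vgt_def)
    moreover have "min (v x) (v y) \<le> v (x + y)" using val_add[OF assms(1) False ne] .
    moreover have "min (v (x + y)) (v y) \<le> v x"
      using val_add[of "x + y" "- y"] assms(1) ne False by simp
    ultimately show ?thesis by (auto simp: min_def split: if_splits)
  qed simp
qed

lemma vge_mult: "\<lbrakk>vge \<gamma> x; vge \<delta> y\<rbrakk> \<Longrightarrow> vge (\<gamma> + \<delta>) (x * y)"
  by (cases "x = 0 \<or> y = 0") (auto simp: vge_def val_mult add_mono)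

lemma subring_val_ring: "subring (val_ring v) LL"
proof -
  have eq: "val_ring v = {x. vge 0 x}" by (simp add: val_ring_def vge_def)
  show ?thesis
    unfolding eq using vge_add[of 0] vge_mult[of 0 _ 0]
    by (intro subring_LL_I) (simp_all add: vge_def[of _ 1])
qed

text \<open>The residue class of x is represented by some c in K, and two representatives of a class
  differ by an element of the maximal ideal.\<close>

lemma residue_field_eq_imp_approx:
  assumes "residue_field v UNIV = residue_field v K" "x \<in> val_ring v"
  shows "\<exists>c\<in>K. vgt 0 (x - c)"
proof -
  define V where "V = LL\<lparr>carrier := val_ring v\<rparr>"
  have coset: "val_ideal v +>\<^bsub>V\<^esub> c = (\<lambda>m. m + c) ` val_ideal v" for c
    by (auto simp: a_r_coset_def r_coset_def V_def)
  have "(\<lambda>c. val_ideal v +>\<^bsub>V\<^esub> c) ` (val_ring v \<inter> UNIV)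
      = (\<lambda>c. val_ideal v +>\<^bsub>V\<^esub> c) ` (val_ring v \<inter> K)"
    using arg_cong[OF assms(1), of carrier] unfolding residue_field_def Let_def V_def by simp
  then obtain c where c: "c \<in> K" "val_ideal v +>\<^bsub>V\<^esub> x = val_ideal v +>\<^bsub>V\<^esub> c"
    using assms(2) by blast
  have "x \<in> (\<lambda>m. m + x) ` val_ideal v"
    by (rule image_eqI[of _ _ 0]) (auto simp: val_ideal_def)
  then have "x \<in> (\<lambda>m. m + c) ` val_ideal v" using c(2) by (simp add: coset)
  then have "x - c \<in> val_ideal v" by auto
  then show ?thesis using c(1) by (auto simp: vgt_def val_ideal_def)
qed

end

subsection \<open>The valuation on a Galois defect extension\<close>

locale galois_defect = galois_prime_auto K p \<sigma> + krull_valuation v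
  for K :: "'l::field set" and p \<sigma> and v :: "'l \<Rightarrow> 'g::linordered_ab_group_add" +
  assumes unique: "unique_extension v K"
    and value_group_eq: "value_group v UNIV = value_group v K"
    and residue_field_eq: "residue_field v UNIV = residue_field v K"
begin

text \<open>The preimage of the valuation ring under \<sigma> is a valuation ring with the same
  trace on K, so uniqueness of the extension applies.\<close>

lemma sigma_val_ring: "\<sigma> x \<in> val_ring v \<longleftrightarrow> x \<in> val_ring v"
proof -
  let ?A = "\<sigma> -` val_ring v"
  note sr = subring_val_ring
  have "subring ?A LL"
    by (rule subring_LL_I) (use subringE(3,5,6,7)[OF sr] in auto)
  moreover have "x \<in> ?A \<or> inverse x \<in> ?A" if "x \<noteq> 0" for x
    using that val_inverse[of "\<sigma> x"] by (auto simp: val_ring_def)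
  ultimately have "valuation_subring ?A" by (simp add: valuation_subring_def)
  moreover have "?A \<inter> K = val_ring v \<inter> K" by (auto simp: sigma_K)
  ultimately have "?A = val_ring v" using unique by (auto simp: unique_extension_def)
  then show ?thesis by blast
qed

text \<open>Invariance of the valuation ring shows only that \<sigma> preserves the sign of values.
  A strict increase from x to \<sigma> x would then repeat along the orbit, against \<sigma>^p =
  id.\<close>

lemma val_sigma [simp]: "v (\<sigma> x) = v x"
proof (cases "x = 0")
  case x0: False
  have sgn: "0 \<le> v (\<sigma> y) \<longleftrightarrow> 0 \<le> v y" if "y \<noteq> 0" for y
    using sigma_val_ring[of y] that by (simp add: val_ring_def)
  have sgn': "0 < v (\<sigma> y) \<longleftrightarrow> 0 < v y" if "y \<noteq> 0" for y
    using sgn[of "inverse y"] that val_inverse[of y] val_inverse[of "\<sigma> y"] by auto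
  have no_gt: "\<not> v x < v (\<sigma> x)" if x: "x \<noteq> 0" for x
  proof
    assume less: "v x < v (\<sigma> x)"
    have ne: "(\<sigma> ^^ i) x \<noteq> 0" for i using x by (induction i) simp_all
    have step: "v ((\<sigma> ^^ i) x) < v ((\<sigma> ^^ Suc i) x)" for i
    proof (induction i)
      case 0
      then show ?case using less by simp
    next
      case (Suc i)
      have "0 < v (\<sigma> ((\<sigma> ^^ Suc i) x / (\<sigma> ^^ i) x))"
        using Suc ne[of i] ne[of "Suc i"] by (subst sgn') (auto simp: val_divide)
      then show ?case using ne[of "Suc i"] ne[of "Suc (Suc i)"] by (simp add: val_divide)
    qed
    have "v ((\<sigma> ^^ 0) x) < v ((\<sigma> ^^ p) x)"
      using lift_Suc_mono_less[of "\<lambda>i. v ((\<sigma> ^^ i) x)", OF step p_pos] .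
    then show False by (simp add: sigma_funpow_p)
  qed
  \<comment> \<open>A strict decrease at x would be a strict increase at its inverse.\<close>
  show ?thesis
    using no_gt[OF x0] no_gt[of "inverse x"] x0 val_inverse[of x] val_inverse[of "\<sigma> x"]
    by (auto simp: not_less)
qed simp

lemma val_sigma_funpow [simp]: "v ((\<sigma> ^^ i) x) = v x"
  by (induction i) simp_all

lemma vgt_sigma [simp]: "vgt \<gamma> (\<sigma> x) \<longleftrightarrow> vgt \<gamma> x"
  by (simp add: vgt_def)

lemma vge_sigma [simp]: "vge \<gamma> (\<sigma> x) \<longleftrightarrow> vge \<gamma> x"
  by (simp add: vge_def)

lemma val_attained:
  assumes "x \<noteq> 0"
  obtains d where "d \<in> K" "d \<noteq> 0" "v d = v x"
proof -
  have "v x \<in> value_group v UNIV" using assms by (simp add: value_group_def)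
  then obtain d where "d \<in> K - {0}" "v x = v d"
    by (auto simp: value_group_eq) (auto simp: value_group_def)
  then show ?thesis using that[of d] by simp
qed

text \<open>Dividing x by an element of K of the same value gives a unit; its residue is then
  approximated from K.\<close>

lemma immediate:
  assumes "x \<noteq> 0"
  shows "\<exists>c\<in>K. vgt (v x) (x - c)"
proof -
  obtain d where d: "d \<in> K" "d \<noteq> 0" "v d = v x" using val_attained[OF assms] .
  have "x / d \<in> val_ring v" using assms d by (simp add: val_ring_def val_divide)
  then obtain e where e: "e \<in> K" "vgt 0 (x / d - e)"
    using residue_field_eq_imp_approx[OF residue_field_eq] by blast
  have "x - e * d = (x / d - e) * d" using d(2) by (simp add: algebra_simps)
  then have "vgt (v x) (x - e * d)"
    using e(2) d by (cases "x / d - e = 0") (auto simp: vgt_def val_mult)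
  then show ?thesis using K_mult[OF e(1) d(1)] by blast
qed

text \<open>For c in K closely approximating b, \<sigma> b - b = \<sigma>(b - c) - (b - c), and both
  terms have value above v b.\<close>

lemma val_sigma_diff_pos:
  assumes "b \<noteq> 0" "b \<notin> K"
  shows "0 < v ((\<sigma> b - b) / b)"
proof -
  obtain c where c: "c \<in> K" "vgt (v b) (b - c)" using immediate[OF assms(1)] by blast
  have "\<sigma> b - b = \<sigma> (b - c) + (- (b - c))" using c(1) by (simp add: sigma_K)
  then have "vgt (v b) (\<sigma> b - b)" using vgt_add[of "v b" "\<sigma> (b - c)" "- (b - c)"] c(2)
    by (simp only: vgt_sigma vgt_uminus)
  moreover have "\<sigma> b - b \<noteq> 0" using assms(2) by (simp add: sigma_eq_self_iff)
  ultimately show ?thesis using assms(1) by (simp add: val_divide vgt_def)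
qed

lemma Sigma_set_eq: "Sigma_set v \<sigma> = {v ((\<sigma> b - b) / b) | b. b \<notin> K}"
  using K_zero by (auto simp: Sigma_set_def sigma_eq_self_iff)

text \<open>Says that v(a - K) is an initial segment of vL: moving c by an element of K whose value
  is smaller than v(a - c) makes that value the new one.\<close>

lemma val_shift:
  assumes a: "a \<notin> K" and c: "c \<in> K" and x: "x \<noteq> 0" "v x \<le> v (a - c)"
  shows "\<exists>c'\<in>K. v (a - c') = v x"
proof (cases "v x = v (a - c)")
  case True
  then show ?thesis using c by metis
next
  case False
  obtain d where d: "d \<in> K" "d \<noteq> 0" "v d = v x" using val_attained[OF x(1)] .
  have "v (a - (c + d)) = v (- d + (a - c))" by (simp add: algebra_simps)
  also have "\<dots> = v (- d)" by (rule val_add_dominant) (use d x False in \<open>auto simp: vgt_def\<close>)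
  finally show ?thesis using d K_add[OF c d(1)] by (intro bexI[of _ "c + d"]) simp_all
qed

lemma final_segment_Sigma_set:
  "final_segment_of (Sigma_set v \<sigma>) {\<alpha> \<in> value_group v K. 0 < \<alpha>}"
  unfolding final_segment_of_def
proof (intro conjI ballI impI)
  show "Sigma_set v \<sigma> \<subseteq> {\<alpha> \<in> value_group v K. 0 < \<alpha>}"
  proof
    fix \<alpha> assume "\<alpha> \<in> Sigma_set v \<sigma>"
    then obtain b where b: "b \<notin> K" "\<alpha> = v ((\<sigma> b - b) / b)" by (auto simp: Sigma_set_eq)
    have b0: "b \<noteq> 0" using b(1) K_zero by auto
    then have "(\<sigma> b - b) / b \<noteq> 0" using b(1) by (simp add: sigma_eq_self_iff)
    then have "\<alpha> \<in> value_group v UNIV" unfolding b(2) by (auto simp: value_group_def)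
    then show "\<alpha> \<in> {\<alpha> \<in> value_group v K. 0 < \<alpha>}"
      using val_sigma_diff_pos[OF b0 b(1)] b(2) value_group_eq by simp
  qed
next
  fix \<alpha> \<beta> assume "\<alpha> \<in> Sigma_set v \<sigma>" "\<beta> \<in> {\<alpha> \<in> value_group v K. 0 < \<alpha>}" and le: "\<alpha> \<le> \<beta>"
  then obtain b e where b: "b \<notin> K" "\<alpha> = v ((\<sigma> b - b) / b)"
    and e: "e \<in> K" "e \<noteq> 0" "\<beta> = v e" by (auto simp: Sigma_set_eq value_group_def)
  have b0: "b \<noteq> 0" using b(1) K_zero by auto
  have ne: "\<sigma> b - b \<noteq> 0" using b(1) by (simp add: sigma_eq_self_iff)
  have "v ((\<sigma> b - b) / e) \<le> v (b - 0)"
    using le b0 ne e b(2) by (simp add: val_divide algebra_simps)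
  \<comment> \<open>Shifting b by c in K leaves \<sigma> b - b unchanged, while v(b - c) can be
    lowered to whatever value turns the quotient into \<beta>.\<close>
  then obtain c where c: "c \<in> K" "v (b - c) = v ((\<sigma> b - b) / e)"
    using val_shift[OF b(1) K_zero, of "(\<sigma> b - b) / e"] ne e(2) by auto
  have bc: "b - c \<notin> K" using K_add[of "b - c" c] c(1) b(1) by auto
  then have "b - c \<noteq> 0" using K_zero by auto
  then have "v ((\<sigma> (b - c) - (b - c)) / (b - c)) = \<beta>"
    using ne c e by (simp add: sigma_K val_divide)
  then show "\<beta> \<in> Sigma_set v \<sigma>" using bc unfolding Sigma_set_eq by blast
qed

text \<open>The difference telescopes into \<sigma>-images of \<sigma> b - b, all of the same
  value.\<close>

lemma vge_sigma_funpow_diff: "b \<notin> K \<Longrightarrow> vge (v (\<sigma> b - b)) ((\<sigma> ^^ k) b - b)"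
proof (induction k)
  case (Suc k)
  have "(\<sigma> ^^ Suc k) b - b = \<sigma> ((\<sigma> ^^ k) b - b) + (\<sigma> b - b)" by simp
  also have "vge (v (\<sigma> b - b)) \<dots>"
    by (rule vge_add) (use Suc in \<open>simp_all del: sigma_diff\<close>, simp add: vge_def)
  finally show ?case .
qed (simp add: vge_def)

end

text \<open>Each of the two automorphisms is a power of the other, so v(\<sigma> b - b) and v(\<tau>
  b - b) bound each other.\<close>

lemma galois_defect_auto_eq:
  assumes "galois_defect K p \<sigma> v" "galois_defect K p \<tau> v"
  shows "Sigma_set v \<sigma> = Sigma_set v \<tau>"
proof -
  have le: "v (\<sigma> b - b) \<le> v (\<tau> b - b)"
    if "galois_defect K p \<sigma> v" "galois_defect K p \<tau> v" "b \<notin> K" for \<sigma> \<tau> b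
  proof -
    interpret s: galois_defect K p \<sigma> v by fact
    interpret t: galois_defect K p \<tau> v by fact
    obtain k where "\<tau> = \<sigma> ^^ k" using s.gal_eq_funpow[OF t.sigma] by blast
    moreover have "\<tau> b - b \<noteq> 0" using that(3) by (simp add: t.sigma_eq_self_iff)
    ultimately show ?thesis
      using s.vge_sigma_funpow_diff[OF that(3), of k] by (simp add: s.vge_def)
  qed
  interpret s: galois_defect K p \<sigma> v by fact
  interpret t: galois_defect K p \<tau> v by fact
  have "v ((\<sigma> b - b) / b) = v ((\<tau> b - b) / b)" if b: "b \<notin> K" for b
  proof -
    have "b \<noteq> 0" using b s.K_zero by auto
    then show ?thesis
      using le[OF assms b] le[OF assms(2,1) b] b
      by (simp add: s.val_divide s.sigma_eq_self_iff t.sigma_eq_self_iff)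
  qed
  then show ?thesis unfolding s.Sigma_set_eq t.Sigma_set_eq by metis
qed

subsection \<open>Values of polynomials along \<open>K\<close>\<close>

locale galois_defect_element = galois_defect K p \<sigma> v
  for K :: "'l::field set" and p \<sigma> and v :: "'l \<Rightarrow> 'g::linordered_ab_group_add" +
  fixes a :: 'l
  assumes a: "a \<notin> K"
begin

section \<open>Approximation of a by elements of K\<close>

lemma a_diff_ne_0: "c \<in> K \<Longrightarrow> a - c \<noteq> 0"
  using a by auto

text \<open>The filter of approximations to a: the sets of all c in K at least as close to a as a
  given c0 form a base, because values are linearly ordered.\<close>

definition near :: "'l filter"
  where "near = (INF c0\<in>K. principal {c \<in> K. v (a - c0) \<le> v (a - c)})"

lemma eventually_near:
  "eventually P near \<longleftrightarrow> (\<exists>c0\<in>K. \<forall>c\<in>K. v (a - c0) \<le> v (a - c) \<longrightarrow> P c)"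
  unfolding near_def
proof (subst eventually_INF_base)
  show "K \<noteq> {}" using K_zero by auto
  fix c1 c2 assume c: "c1 \<in> K" "c2 \<in> K"
  let ?F = "\<lambda>c0. principal {c \<in> K. v (a - c0) \<le> v (a - c)}"
  have "(if v (a - c1) \<le> v (a - c2) then c2 else c1) \<in> K" using c by simp
  then show "\<exists>x\<in>K. ?F x \<le> inf (?F c1) (?F c2)"
    by (rule bexI[rotated]) (auto simp: eventually_principal)
qed (auto simp: eventually_principal)

lemma near_ne_bot: "near \<noteq> bot"
  using K_zero by (auto simp: trivial_limit_def eventually_near)

lemma eventually_near_K: "eventually (\<lambda>c. c \<in> K) near"
  using K_zero by (auto simp: eventually_near)

text \<open>No element of K is a best approximation to a: approximating a - c0 from K improves
  c0.\<close>

lemma eventually_near_closer: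
  assumes "c0 \<in> K"
  shows "eventually (\<lambda>c. v (a - c0) < v (a - c)) near"
proof -
  obtain d where d: "d \<in> K" "vgt (v (a - c0)) (a - c0 - d)"
    using immediate[OF a_diff_ne_0[OF assms]] by blast
  have K: "c0 + d \<in> K" using assms d K_add by blast
  then have "v (a - c0) < v (a - (c0 + d))"
    using d(2) a_diff_ne_0[OF K] by (auto simp: vgt_def algebra_simps)
  then show ?thesis using K by (auto simp: eventually_near intro: less_le_trans)
qed

text \<open>Writing \<open>\<beta> = v g\<close> and \<open>h v (a - c) = v ((a - c)\<^sup>h)\<close> avoids multiples in the value group.\<close>

definition slope :: "'l poly \<Rightarrow> nat \<Rightarrow> bool"
  where "slope q h \<longleftrightarrow>
    (\<exists>g. g \<noteq> 0 \<and> eventually (\<lambda>c. poly q c \<noteq> 0 \<and> v (poly q c) = v (g * (a - c) ^ h)) near)"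

text \<open>With n = h2 - h1 > 0 the values differ by v g2 + n v(a - c) - v g1, which strictly
  increases with v(a - c). Either it is nonnegative for some c0, and positive from then on, or it is
  negative throughout.\<close>

lemma monomials_comparable_less:
  assumes g: "g1 \<noteq> 0" "g2 \<noteq> 0" and h: "h1 < h2"
  shows "eventually (\<lambda>c. v (g1 * (a - c) ^ h1) < v (g2 * (a - c) ^ h2)) near \<or>
    eventually (\<lambda>c. v (g2 * (a - c) ^ h2) < v (g1 * (a - c) ^ h1)) near"
proof -
  define n where "n = h2 - h1"
  have n: "0 < n" "h2 = h1 + n" using h by (simp_all add: n_def)
  have v1: "v (g1 * (a - c) ^ h1) = v g1 + v ((a - c) ^ h1)" if "c \<in> K" for c
    using g a_diff_ne_0[OF that] by (simp add: val_mult)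
  have v2: "v (g2 * (a - c) ^ h2) = v g2 + v ((a - c) ^ n) + v ((a - c) ^ h1)" if "c \<in> K" for c
    using g a_diff_ne_0[OF that] by (simp add: val_mult n(2) power_add algebra_simps)
  show ?thesis
  proof (cases "\<exists>c0\<in>K. v g1 \<le> v g2 + v ((a - c0) ^ n)")
    case True
    then obtain c0 where c0: "c0 \<in> K" "v g1 \<le> v g2 + v ((a - c0) ^ n)" by blast
    have "eventually (\<lambda>c. v (g1 * (a - c) ^ h1) < v (g2 * (a - c) ^ h2)) near"
      using eventually_near_closer[OF c0(1)] eventually_near_K
    proof eventually_elim
      case (elim c)
      have "v ((a - c0) ^ n) < v ((a - c) ^ n)"
        using val_power_strict_mono[OF a_diff_ne_0 a_diff_ne_0] elim c0(1) n(1) by blast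
      then have "v g1 < v g2 + v ((a - c) ^ n)"
        using c0(2) by (meson add_strict_left_mono le_less_trans)
      then show ?case using elim(2) by (simp add: v1 v2)
    qed
    then show ?thesis ..
  next
    case False
    have "eventually (\<lambda>c. v (g2 * (a - c) ^ h2) < v (g1 * (a - c) ^ h1)) near"
      using eventually_near_K
    proof eventually_elim
      case (elim c)
      then show ?case using False by (auto simp: v1 v2 not_le)
    qed
    then show ?thesis ..
  qed
qed

lemma monomials_comparable:
  assumes "g1 \<noteq> 0" "g2 \<noteq> 0" "h1 \<noteq> h2"
  shows "eventually (\<lambda>c. v (g1 * (a - c) ^ h1) < v (g2 * (a - c) ^ h2)) near \<or>
    eventually (\<lambda>c. v (g2 * (a - c) ^ h2) < v (g1 * (a - c) ^ h1)) near"
  using monomials_comparable_less[of g1 g2 h1 h2] monomials_comparable_less[of g2 g1 h2 h1] assms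
  by (auto simp: neq_iff)

text \<open>Monomials with different exponents are eventually strictly comparable, so their values
  cannot eventually agree along a proper filter.\<close>

lemma slope_unique:
  assumes "slope q h1" "slope q h2"
  shows "h1 = h2"
proof (rule ccontr)
  assume ne: "h1 \<noteq> h2"
  obtain g1 where g1: "g1 \<noteq> 0" "eventually (\<lambda>c. v (poly q c) = v (g1 * (a - c) ^ h1)) near"
    using assms(1) by (auto simp: slope_def eventually_conj_iff)
  obtain g2 where g2: "g2 \<noteq> 0" "eventually (\<lambda>c. v (poly q c) = v (g2 * (a - c) ^ h2)) near"
    using assms(2) by (auto simp: slope_def eventually_conj_iff)
  have "eventually (\<lambda>c. v (g1 * (a - c) ^ h1) = v (g2 * (a - c) ^ h2)) near"
    using g1(2) g2(2) by eventually_elim simp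
  then have "eventually (\<lambda>c. \<not> v (g1 * (a - c) ^ h1) < v (g2 * (a - c) ^ h2) \<and>
      \<not> v (g2 * (a - c) ^ h2) < v (g1 * (a - c) ^ h1)) near"
    by eventually_elim simp
  then have "eventually (\<lambda>c. False) near"
    using monomials_comparable[OF g1(1) g2(1) ne]
    by (auto elim: eventually_elim2)
  then show False using near_ne_bot by (simp add: trivial_limit_def)
qed

lemma slope_mult:
  assumes "slope q h" "slope q' h'"
  shows "slope (q * q') (h + h')"
proof -
  obtain g where g: "g \<noteq> 0"
    "eventually (\<lambda>c. poly q c \<noteq> 0 \<and> v (poly q c) = v (g * (a - c) ^ h)) near"
    using assms(1) by (auto simp: slope_def)
  obtain g' where g': "g' \<noteq> 0"
    "eventually (\<lambda>c. poly q' c \<noteq> 0 \<and> v (poly q' c) = v (g' * (a - c) ^ h')) near"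
    using assms(2) by (auto simp: slope_def)
  have "eventually (\<lambda>c. poly (q * q') c \<noteq> 0 \<and>
      v (poly (q * q') c) = v (g * g' * (a - c) ^ (h + h'))) near"
    using g(2) g'(2) eventually_near_K
  proof eventually_elim
    case (elim c)
    then show ?case
      using g(1) g'(1) a_diff_ne_0[of c] by (simp add: val_mult power_add algebra_simps)
  qed
  then show ?thesis using g(1) g'(1) by (auto simp: slope_def intro!: exI[of _ "g * g'"])
qed

lemma slope_const: "k \<noteq> 0 \<Longrightarrow> slope [:k:] 0"
  by (auto simp: slope_def intro!: exI[of _ k])

lemma slope_prod:
  "(\<And>i. i \<in> A \<Longrightarrow> slope (q i) (h i)) \<Longrightarrow> slope (prod q A) (sum h A)"
  by (induction A rule: infinite_finite_induct) (simp_all add: slope_mult slope_const one_pCons)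

lemma slope_add:
  assumes "slope q h" "slope q' h'" "h \<noteq> h'"
  shows "slope (q + q') h \<or> slope (q + q') h'"
proof -
  obtain g where g: "g \<noteq> 0"
    "eventually (\<lambda>c. poly q c \<noteq> 0 \<and> v (poly q c) = v (g * (a - c) ^ h)) near"
    using assms(1) by (auto simp: slope_def)
  obtain g' where g': "g' \<noteq> 0"
    "eventually (\<lambda>c. poly q' c \<noteq> 0 \<and> v (poly q' c) = v (g' * (a - c) ^ h')) near"
    using assms(2) by (auto simp: slope_def)
  from monomials_comparable[OF g(1) g'(1) assms(3)] show ?thesis
  proof
    assume "eventually (\<lambda>c. v (g * (a - c) ^ h) < v (g' * (a - c) ^ h')) near"
    then have "eventually (\<lambda>c. poly (q + q') c \<noteq> 0 \<and>
        v (poly (q + q') c) = v (g * (a - c) ^ h)) near"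
      using g(2) g'(2)
    proof eventually_elim
      case (elim c)
      then show ?case
        using add_dominant_ne_0[of "poly q c" "poly q' c"] val_add_dominant[of "poly q c" "poly q' c"]
        by (simp add: vgt_def)
    qed
    then show ?thesis using g(1) by (auto simp: slope_def)
  next
    assume "eventually (\<lambda>c. v (g' * (a - c) ^ h') < v (g * (a - c) ^ h)) near"
    then have "eventually (\<lambda>c. poly (q + q') c \<noteq> 0 \<and>
        v (poly (q + q') c) = v (g' * (a - c) ^ h')) near"
      using g(2) g'(2)
    proof eventually_elim
      case (elim c)
      then show ?case
        using add_dominant_ne_0[of "poly q' c" "poly q c"] val_add_dominant[of "poly q' c" "poly q c"]
        by (simp add: vgt_def add.commute)
    qed
    then show ?thesis using g'(1) by (auto simp: slope_def)
  qed
qed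

text \<open>Eventual strict comparison of values is a total order on finitely many monomials with
  distinct exponents, so there is a least one.\<close>

lemma dominant_monomial:
  assumes "finite S" "S \<noteq> {}" "\<And>i. i \<in> S \<Longrightarrow> g i \<noteq> 0"
  shows "\<exists>h\<in>S. \<forall>i\<in>S - {h}. eventually (\<lambda>c. v (g h * (a - c) ^ h) < v (g i * (a - c) ^ i)) near"
  using assms
proof (induction S rule: finite_ne_induct)
  case (insert x S)
  let ?less = "\<lambda>i j. eventually (\<lambda>c. v (g i * (a - c) ^ i) < v (g j * (a - c) ^ j)) near"
  obtain h where h: "h \<in> S" "\<And>i. i \<in> S - {h} \<Longrightarrow> ?less h i"
    using insert by blast
  have "h \<noteq> x" using insert.hyps h(1) by blast
  then consider "?less h x" | "?less x h"
    using monomials_comparable[of "g h" "g x" h x] insert.prems h(1) by blast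
  then show ?case
  proof cases
    case 1
    then show ?thesis using h by blast
  next
    case 2
    have "?less x i" if "i \<in> S" for i
    proof (cases "i = h")
      case False
      then have "?less h i" using h(2) that by blast
      with 2 show ?thesis by eventually_elim (rule less_trans)
    qed (use 2 in simp)
    then show ?thesis by blast
  qed
qed simp

text \<open>\<open>pcompose q [:a, -1:]\<close> is q(a - X). Its coefficients are, up to sign, the
  Taylor coefficients of q at a, and its value at a - c is q(c), so a dominant monomial determines
  v(q(c)) near a.\<close>

lemma taylor_dominant:
  assumes "q \<noteq> 0"
  obtains g h where "g = pcompose q [:a, -1:]" "h \<le> degree q" "coeff g h \<noteq> 0"
    and "eventually (\<lambda>c. \<forall>i. i \<noteq> h \<longrightarrow> vgt (v (coeff g h * (a - c) ^ h)) (coeff g i * (a - c) ^ i)) near"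
    and "slope q h"
proof -
  define g where "g = pcompose q [:a, -1:]"
  have deg: "degree g = degree q" by (simp add: g_def degree_pcompose)
  then have g0: "g \<noteq> 0" using assms by (auto simp: g_def pcompose_eq_0)
  let ?S = "{i. coeff g i \<noteq> 0}"
  have "?S \<subseteq> {..degree g}" by (auto intro: le_degree)
  then have fin: "finite ?S" by (rule finite_subset) simp
  have "?S \<noteq> {}" using g0 by (auto simp: poly_eq_iff)
  then obtain h where h: "coeff g h \<noteq> 0"
    "\<And>i. i \<in> ?S - {h} \<Longrightarrow> eventually (\<lambda>c. v (coeff g h * (a - c) ^ h) < v (coeff g i * (a - c) ^ i)) near"
    using dominant_monomial[OF fin, of "coeff g"] by blast
  have "eventually (\<lambda>c. \<forall>i\<in>?S - {h}. v (coeff g h * (a - c) ^ h) < v (coeff g i * (a - c) ^ i)) near"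
    using h(2) fin by (intro eventually_ball_finite) auto
  then have ev: "eventually (\<lambda>c. \<forall>i. i \<noteq> h \<longrightarrow>
      vgt (v (coeff g h * (a - c) ^ h)) (coeff g i * (a - c) ^ i)) near"
    by eventually_elim (auto simp: vgt_def)
  have "h \<le> degree q" using h(1) deg le_degree by metis
  have "eventually (\<lambda>c. poly q c \<noteq> 0 \<and> v (poly q c) = v (coeff g h * (a - c) ^ h)) near"
    using ev eventually_near_K
  proof eventually_elim
    case (elim c)
    let ?t = "\<lambda>i. coeff g i * (a - c) ^ i"
    have "poly q c = poly g (a - c)" by (simp add: g_def poly_pcompose)
    also have "\<dots> = (\<Sum>i\<le>degree g. ?t i)" by (rule poly_altdef)
    also have "\<dots> = ?t h + (\<Sum>i\<in>{..degree g} - {h}. ?t i)"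
      using \<open>h \<le> degree q\<close> deg by (intro sum.remove) auto
    finally have eq: "poly q c = ?t h + (\<Sum>i\<in>{..degree g} - {h}. ?t i)" .
    have t0: "?t h \<noteq> 0" using h(1) a_diff_ne_0[OF elim(2)] by simp
    have "vgt (v (?t h)) (\<Sum>i\<in>{..degree g} - {h}. ?t i)"
      using elim(1) by (intro vgt_sum) auto
    then show ?case using add_dominant_ne_0[OF t0] val_add_dominant[OF t0] by (simp add: eq)
  qed
  then have "slope q h" using h(1) by (auto simp: slope_def)
  then show ?thesis using that g_def h(1) ev \<open>h \<le> degree q\<close> by blast
qed

text \<open>\<sigma> preserves v and fixes c, so every conjugate of a is as far from c as a is, and
  each of the p linear factors has slope 1.\<close>

lemma slope_minimal_polynomial: "slope (\<Prod>i<p. [:- (\<sigma> ^^ i) a, 1:]) p"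
proof -
  have "slope [:- (\<sigma> ^^ i) a, 1:] 1" for i
  proof -
    have "eventually (\<lambda>c. poly [:- (\<sigma> ^^ i) a, 1:] c \<noteq> 0 \<and>
        v (poly [:- (\<sigma> ^^ i) a, 1:] c) = v (1 * (a - c) ^ 1)) near"
      using eventually_near_K
    proof eventually_elim
      case (elim c)
      have fixed: "(\<sigma> ^^ i) c = c" using elim sigma_funpow[of i] by (auto simp: gal_iff)
      have diff: "(\<sigma> ^^ i) (a - c) = (\<sigma> ^^ i) a - (\<sigma> ^^ i) c" by (induction i) simp_all
      have "v ((\<sigma> ^^ i) a - c) = v (a - c)"
        using val_sigma_funpow[of i "a - c"] diff fixed by simp
      moreover have "(\<sigma> ^^ i) a \<noteq> c"
        using fixed sigma_funpow_eq_iff[of i a c] a elim by auto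
      ultimately show ?case by (simp add: val_minus_commute[of c])
    qed
    then show ?thesis unfolding slope_def by (intro exI[of _ 1]) simp
  qed
  then have "slope (\<Prod>i<p. [:- (\<sigma> ^^ i) a, 1:]) (\<Sum>i<p. 1)" by (rule slope_prod)
  then show ?thesis by simp
qed

text \<open>The root e lies in K. Once c is closer to a than e is, c - e has the constant value v(a
  - e).\<close>

lemma slope_linear:
  assumes "k0 \<in> K" "k1 \<in> K" "k1 \<noteq> 0"
  shows "slope [:k0, k1:] 0"
proof -
  define e where "e = - k0 / k1"
  have e: "e \<in> K" using assms by (simp add: e_def K_uminus K_divide)
  have "eventually (\<lambda>c. poly [:k0, k1:] c \<noteq> 0 \<and>
      v (poly [:k0, k1:] c) = v (k1 * (a - e) * (a - c) ^ 0)) near"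
    using eventually_near_closer[OF e] eventually_near_K
  proof eventually_elim
    case (elim c)
    have eq: "poly [:k0, k1:] c = k1 * ((a - e) + - (a - c))"
      using assms(3) by (simp add: e_def field_simps)
    have gt: "vgt (v (a - e)) (- (a - c))" using elim(1) by (simp add: vgt_def del: minus_diff_eq)
    show ?case
      unfolding eq using assms(3) a_diff_ne_0[OF e] val_add_dominant[OF a_diff_ne_0[OF e] gt]
        add_dominant_ne_0[OF a_diff_ne_0[OF e] gt] by (simp add: val_mult del: minus_diff_eq)
  qed
  then show ?thesis
    unfolding slope_def using assms(3) a_diff_ne_0[OF e] by (intro exI[of _ "k1 * (a - e)"]) simp
qed

text \<open>The terms of the \<open>f\<close>-adic expansion of \<open>q\<close> have the distinct slopes \<open>j h\<close>, so one of them dominates.\<close>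

lemma slope_adic_expansion:
  assumes f: "f \<in> polys_over K" "0 < degree f" "slope f h" "0 < h"
    and min: "\<And>r. \<lbrakk>r \<in> polys_over K; r \<noteq> 0; degree r < degree f\<rbrakk> \<Longrightarrow> slope r 0"
    and q: "q \<in> polys_over K" "q \<noteq> 0"
  shows "\<exists>j. j * degree f \<le> degree q \<and> slope q (j * h)"
  using q
proof (induction "degree q" arbitrary: q rule: less_induct)
  case less
  note div_mod = polys_over_div_mod[OF subfield_K f(1) less.prems(1)]
  have f0: "f \<noteq> 0" using f(2) by auto
  have q_eq: "q = q div f * f + q mod f" by simp
  show ?case
  proof (cases "q div f = 0")
    case True
    then have "degree q < degree f" using f0 less.prems(2) by (simp add: div_poly_eq_0_iff)
    then show ?thesis using min[OF less.prems] by (intro exI[of _ 0]) simp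
  next
    case False
    have deg: "degree q = degree (q div f) + degree f"
    proof -
      have "degree (q mod f) < degree (q div f * f)"
        using degree_mod_less[OF f0, of q] f(2) False f0 by (auto simp: degree_mult_eq)
      then show ?thesis
        using degree_add_eq_left[of "q mod f" "q div f * f"] False f0 by (simp add: degree_mult_eq)
    qed
    obtain j where j: "j * degree f \<le> degree (q div f)" "slope (q div f) (j * h)"
      using less.hyps[of "q div f"] deg f(2) div_mod(1) False by auto
    have slope1: "slope (q div f * f) (Suc j * h)"
      using slope_mult[OF j(2) f(3)] by (simp add: add.commute)
    have le: "Suc j * degree f \<le> degree q" using j(1) deg by simp
    show ?thesis
    proof (cases "q mod f = 0")
      case True
      then show ?thesis using slope1 le q_eq by (intro exI[of _ "Suc j"]) simp
    next
      case False
      have "slope (q mod f) 0"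
        using min[OF div_mod(2) False] degree_mod_less[OF f0, of q] False by simp
      \<comment> \<open>Since h > 0 the two summands have different slopes; if the remainder
        dominates, j = 0 serves.\<close>
      then have "slope q (Suc j * h) \<or> slope q 0"
        using slope_add[OF slope1, of "q mod f" 0] f(4) q_eq by simp
      then show ?thesis using le by (metis mult_0 le0)
    qed
  qed
qed

lemma slope_zero:
  assumes "f \<in> polys_over K" "f \<noteq> 0" "degree f < p"
  shows "slope f 0"
proof (rule ccontr)
  let ?P = "\<lambda>f. f \<in> polys_over K \<and> f \<noteq> 0 \<and> degree f < p \<and> \<not> slope f 0"
  assume "\<not> slope f 0"
  then have "\<exists>f. ?P f" using assms by blast
  then obtain f where f: "?P f" and min: "\<And>r. ?P r \<Longrightarrow> degree f \<le> degree r"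
    using ex_has_least_nat[of ?P _ degree] by blast
  obtain h where h: "slope f h" "h \<le> degree f" using taylor_dominant[of f] f by blast
  have h0: "0 < h" using h f by (cases h) auto
  have d0: "0 < degree f" using h h0 by simp
  \<comment> \<open>Degree 1 has to be excluded separately: the case h = 1, j = p below only yields
    degree at most 1.\<close>
  have d1: "1 < degree f"
  proof (rule ccontr)
    assume "\<not> 1 < degree f"
    then have "degree f = 1" using d0 by simp
    moreover from this have "f = [:coeff f 0, coeff f 1:]"
      by (auto simp: poly_eq_iff coeff_pCons coeff_eq_0 split: nat.splits)
    ultimately obtain k0 k1 where "f = [:k0, k1:]" "k1 \<noteq> 0"
      using f leading_coeff_0_iff[of f] by metis
    then show False using slope_linear[of k0 k1] f subfield_K by simp
  qed
  have min': "slope r 0" if "r \<in> polys_over K" "r \<noteq> 0" "degree r < degree f" for r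
    using min[of r] that f by (meson leD less_trans)
  let ?M = "\<Prod>i<p. [:- (\<sigma> ^^ i) a, 1:]"
  have "?M \<noteq> 0" by simp
  then obtain j where j: "j * degree f \<le> degree ?M" "slope ?M (j * h)"
    using slope_adic_expansion[OF _ d0 h(1) h0 min' minimal_polynomial[OF a]] f by blast
  have "degree ?M = p" by (subst degree_prod_eq_sum_degree) auto
  moreover have "p = j * h" using slope_unique[OF slope_minimal_polynomial j(2)] .
  ultimately have j': "p = j * h" "j * degree f \<le> p" using j(1) by simp_all
  \<comment> \<open>If j = 1, then h = p exceeds the degree of f; if h = 1, then j = p forces that
    degree down to 1.\<close>
  then have "j = 1 \<or> h = 1" using prime_p prime_product by blast
  then show False
  proof
    assume "j = 1"
    then show False using j' h(2) f by simp
  next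
    assume "h = 1"
    then have "p * degree f \<le> p * 1" using j' by simp
    then show False using d1 p_pos by (simp only: mult_le_cancel1) simp
  qed
qed

text \<open>The elements a - c already give arbitrarily small values in the set Sigma: with b =
  f(a), a suitable c is any point near a at which the constant term of the expansion of f
  dominates.\<close>

lemma Sigma_coinitial:
  assumes b: "b \<notin> K"
  shows "\<exists>c\<in>K. v ((\<sigma> a - a) / (a - c)) \<le> v ((\<sigma> b - b) / b)"
proof -
  obtain f where f: "f \<in> polys_over K" "degree f < p" "b = poly f a"
    using primitive_element[OF subfield_K dimension_K prime_p a] by blast
  have b0: "b \<noteq> 0" using b K_zero by auto
  then have f0: "f \<noteq> 0" using f(3) by auto
  obtain g h where g: "g = pcompose f [:a, -1:]" and "h \<le> degree f" "coeff g h \<noteq> 0"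
    and ev: "eventually (\<lambda>c. \<forall>i. i \<noteq> h \<longrightarrow>
      vgt (v (coeff g h * (a - c) ^ h)) (coeff g i * (a - c) ^ i)) near"
    and h: "slope f h"
    by (rule taylor_dominant[OF f0])
  \<comment> \<open>The dominant index is the slope of f, which is 0 in degree below p; the
    coefficient at 0 is f(a) = b.\<close>
  have h0: "h = 0" using slope_unique[OF h slope_zero[OF f(1) f0 f(2)]] .
  have g0: "coeff g 0 = b"
    using f(3) g poly_pcompose[of f "[:a, -1:]" 0] by (simp add: poly_0_coeff_0)
  have "eventually (\<lambda>c. c \<in> K \<and> (\<forall>i. i \<noteq> 0 \<longrightarrow> vgt (v b) (coeff g i * (a - c) ^ i))) near"
    using ev eventually_near_K by eventually_elim (simp add: h0 g0)
  then obtain c where c: "c \<in> K" "\<And>i. i \<noteq> 0 \<Longrightarrow> vgt (v b) (coeff g i * (a - c) ^ i)"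
    using near_ne_bot eventually_happens by blast
  \<comment> \<open>As g is f(a - X), it takes the value f(c) at t and f(\<sigma> a) = \<sigma> b at
    y.\<close>
  define t y where "t = a - c" and "y = a - \<sigma> a"
  have t: "t \<notin> K" "t \<noteq> 0" using a_diff_ne_0[OF c(1)] K_add[OF _ c(1), of t] a by (auto simp: t_def)
  have y: "y = - (\<sigma> t - t)" using c(1) by (simp add: t_def y_def sigma_K)
  have y0: "y \<noteq> 0" using t(1) sigma_eq_self_iff[of t] by (auto simp: y)
  have \<delta>: "0 < v (y / t)"
    using val_sigma_diff_pos[OF t(2,1)] by (simp only: y divide_minus_left val_uminus)
  have "\<sigma> b = poly g y" using f(1,3) by (simp add: g poly_pcompose sigma_poly y_def)
  also have "\<dots> = (\<Sum>i\<le>degree g. coeff g i * y ^ i)" by (rule poly_altdef)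
  also have "\<dots> = b + (\<Sum>i\<in>{..degree g} - {0}. coeff g i * y ^ i)"
    using g0 by (subst sum.remove[of _ 0]) auto
  finally have eq: "\<sigma> b - b = (\<Sum>i\<in>{..degree g} - {0}. coeff g i * y ^ i)" by simp
  \<comment> \<open>Replacing t by y multiplies the i-th term, of value above v b, by (y/t)^i; as
    v(y/t) > 0, this adds at least v(y/t).\<close>
  have "vge (v b + v (y / t)) (coeff g i * y ^ i)" if "i \<noteq> 0" for i
  proof -
    have "vge (v b) (coeff g i * t ^ i)" using c(2)[OF that] by (auto simp: vge_def vgt_def t_def)
    moreover have "vge (v (y / t)) ((y / t) ^ i)"
      using val_le_val_power[of "y / t" i] \<delta> that t(2) y0 by (simp add: vge_def)
    ultimately have "vge (v b + v (y / t)) (coeff g i * t ^ i * (y / t) ^ i)" by (rule vge_mult)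
    also have "coeff g i * t ^ i * (y / t) ^ i = coeff g i * y ^ i"
      using t(2) by (simp add: power_divide)
    finally show ?thesis .
  qed
  then have "vge (v b + v (y / t)) (\<sigma> b - b)" unfolding eq by (intro vge_sum) simp
  moreover have "\<sigma> b - b \<noteq> 0" using b by (simp add: sigma_eq_self_iff)
  ultimately have "v (y / t) \<le> v ((\<sigma> b - b) / b)"
    using b0 by (simp add: vge_def val_divide algebra_simps)
  moreover have "v (y / t) = v ((\<sigma> a - a) / (a - c))"
    using val_uminus[of "y / t"] by (simp add: y_def t_def minus_divide_left)
  ultimately show ?thesis using c(1) by auto
qed

text \<open>For \<subseteq>, \<open>Sigma_coinitial\<close> gives a value of the right side below
  \<alpha>, and by \<open>val_shift\<close> the right side is upward closed in vL.\<close>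

lemma Sigma_set_conv_val_diff:
  "Sigma_set v \<sigma> = (\<lambda>\<alpha>. v (\<sigma> a - a) + \<alpha>) ` uminus ` val_diff v a K"
proof -
  have ne: "\<sigma> a - a \<noteq> 0" using a by (simp add: sigma_eq_self_iff)
  have eq: "(\<lambda>\<alpha>. v (\<sigma> a - a) + \<alpha>) ` uminus ` val_diff v a K = (\<lambda>c. v (\<sigma> a - a) - v (a - c)) ` K"
    by (simp add: val_diff_def image_image)
  show ?thesis
    unfolding eq
  proof (intro equalityI subsetI)
    fix \<alpha> assume "\<alpha> \<in> Sigma_set v \<sigma>"
    then obtain b where b: "b \<notin> K" "\<alpha> = v ((\<sigma> b - b) / b)" by (auto simp: Sigma_set_eq)
    have ne': "\<sigma> b - b \<noteq> 0" "b \<noteq> 0" using b(1) K_zero by (auto simp: sigma_eq_self_iff)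
    obtain c where c: "c \<in> K" "v ((\<sigma> a - a) / (a - c)) \<le> v ((\<sigma> b - b) / b)"
      using Sigma_coinitial[OF b(1)] by blast
    \<comment> \<open>Chosen so that any c' with v(a - c') = v x represents \<alpha>.\<close>
    define x where "x = (\<sigma> a - a) / ((\<sigma> b - b) / b)"
    have x: "x \<noteq> 0" "v x = v (\<sigma> a - a) - \<alpha>"
      using ne ne' b(2) val_divide[OF ne, of "(\<sigma> b - b) / b"] by (simp_all add: x_def)
    have "v (\<sigma> a - a) - v (a - c) \<le> \<alpha>"
      using c(2) b(2) val_divide[OF ne a_diff_ne_0[OF c(1)]] by simp
    then have "v x \<le> v (a - c)" by (simp only: x(2) diff_le_eq add.commute)
    then obtain c' where "c' \<in> K" "v (a - c') = v x" using val_shift[OF a c(1) x(1)] by blast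
    then show "\<alpha> \<in> (\<lambda>c. v (\<sigma> a - a) - v (a - c)) ` K" using x(2) by (auto intro!: image_eqI[of _ _ c'])
  next
    fix \<alpha> assume "\<alpha> \<in> (\<lambda>c. v (\<sigma> a - a) - v (a - c)) ` K"
    then obtain c where c: "c \<in> K" "\<alpha> = v (\<sigma> a - a) - v (a - c)" by blast
    have "a - c \<notin> K" using K_add[OF _ c(1), of "a - c"] a by auto
    moreover have "\<alpha> = v ((\<sigma> (a - c) - (a - c)) / (a - c))"
      using c ne a_diff_ne_0[OF c(1)] by (simp add: val_divide sigma_K)
    ultimately show "\<alpha> \<in> Sigma_set v \<sigma>" unfolding Sigma_set_eq by blast
  qed
qed

end

subsection \<open>Modules given by sets of values\<close>

text \<open>The common shape of \<open>I_ext\<close> and \<open>I_diff\<close>, which reduces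
  questions about them to sets of values.\<close>

definition val_module :: "('l::field \<Rightarrow> 'g) \<Rightarrow> 'g set \<Rightarrow> 'l set"
  where "val_module v S = {b. b \<noteq> 0 \<and> v b \<in> S} \<union> {0}"

context krull_valuation
begin

lemma val_module_translate:
  assumes "t \<noteq> 0"
  shows "val_module v ((\<lambda>\<alpha>. v t + \<alpha>) ` S) = (\<lambda>x. t * x) ` val_module v S"
proof (intro equalityI subsetI)
  fix b assume b: "b \<in> val_module v ((\<lambda>\<alpha>. v t + \<alpha>) ` S)"
  have "b / t \<in> val_module v S"
    using b assms by (cases "b = 0") (auto simp: val_module_def val_divide)
  then show "b \<in> (\<lambda>x. t * x) ` val_module v S"
    using assms by (intro image_eqI[of _ _ "b / t"]) auto
next
  fix b assume "b \<in> (\<lambda>x. t * x) ` val_module v S"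
  then show "b \<in> val_module v ((\<lambda>\<alpha>. v t + \<alpha>) ` S)"
    using assms by (auto simp: val_module_def val_mult)
qed

lemma mult_val_module_subset_iff:
  assumes "S \<subseteq> value_group v UNIV" "b \<noteq> 0"
  shows "b \<in> mult_ring (val_module v S) \<longleftrightarrow> (\<lambda>\<alpha>. \<alpha> + v b) ` S \<subseteq> S"
proof
  assume b: "b \<in> mult_ring (val_module v S)"
  show "(\<lambda>\<alpha>. \<alpha> + v b) ` S \<subseteq> S"
  proof
    fix \<beta> assume "\<beta> \<in> (\<lambda>\<alpha>. \<alpha> + v b) ` S"
    then obtain \<alpha> where "\<alpha> \<in> S" "\<beta> = \<alpha> + v b" by blast
    moreover from this obtain x where "x \<noteq> 0" "v x = \<alpha>"
      using assms(1) by (force simp: value_group_def)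
    ultimately have x: "x \<noteq> 0" "v x \<in> S" "\<beta> = v (b * x)"
      using assms(2) by (simp_all add: val_mult add.commute)
    then have "b * x \<in> val_module v S"
      using b by (auto simp: mult_ring_def val_module_def)
    then show "\<beta> \<in> S" using x assms(2) by (simp add: val_module_def)
  qed
next
  assume "(\<lambda>\<alpha>. \<alpha> + v b) ` S \<subseteq> S"
  then show "b \<in> mult_ring (val_module v S)"
    using assms(2) by (auto simp: mult_ring_def val_module_def val_mult add.commute)
qed

text \<open>An element x is a unit exactly if x and its inverse both map the module into itself,
  that is, S + v x \<subseteq> S and S - v x \<subseteq> S, which together say S + v x = S.\<close>

lemma unit_values_mult_ring_val_module:
  assumes S: "S \<subseteq> value_group v UNIV"
  shows "unit_values v (mult_ring (val_module v S)) = inv_group v S"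
proof -
  let ?O = "mult_ring (val_module v S)"
  have Units: "x \<in> Units (LL\<lparr>carrier := ?O\<rparr>) \<longleftrightarrow> x \<noteq> 0 \<and> x \<in> ?O \<and> inverse x \<in> ?O" for x
    unfolding Units_def by (auto simp: inverse_unique intro: bexI[of _ "inverse x"])
  have ne: "x \<in> Units (LL\<lparr>carrier := ?O\<rparr>) \<longleftrightarrow> (\<lambda>\<alpha>. \<alpha> + v x) ` S = S" if x: "x \<noteq> 0" for x
  proof -
    have "x \<in> Units (LL\<lparr>carrier := ?O\<rparr>) \<longleftrightarrow>
        (\<lambda>\<alpha>. \<alpha> + v x) ` S \<subseteq> S \<and> (\<lambda>\<alpha>. \<alpha> + - v x) ` S \<subseteq> S"
      using x by (simp add: Units mult_val_module_subset_iff[OF S] val_inverse)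
    also have "(\<lambda>\<alpha>. \<alpha> + - v x) ` S \<subseteq> S \<longleftrightarrow> S \<subseteq> (\<lambda>\<alpha>. \<alpha> + v x) ` S"
      by (force simp: image_subset_iff image_iff)
    finally show ?thesis by blast
  qed
  have "Units (LL\<lparr>carrier := ?O\<rparr>) = {x. x \<noteq> 0 \<and> (\<lambda>\<alpha>. \<alpha> + v x) ` S = S}"
  proof (rule Set.set_eqI)
    fix x
    show "x \<in> Units (LL\<lparr>carrier := ?O\<rparr>) \<longleftrightarrow> x \<in> {x. x \<noteq> 0 \<and> (\<lambda>\<alpha>. \<alpha> + v x) ` S = S}"
      using Units[of x] ne[of x] unfolding mem_Collect_eq by argo
  qed
  then have "unit_values v ?O = v ` {x. x \<noteq> 0 \<and> (\<lambda>\<alpha>. \<alpha> + v x) ` S = S}"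
    by (simp only: unit_values_def)
  also have "\<dots> = inv_group v S"
    unfolding inv_group_def value_group_def by blast
  finally show ?thesis .
qed

end

text \<open>If S + \<gamma> = S, then -S + \<gamma> = -(S + \<gamma>) + \<gamma> = -S; the converse
  is the same for -S.\<close>

lemma inv_group_uminus: "inv_group v (uminus ` S) = inv_group v S"
proof -
  have sub: "(\<lambda>\<alpha>. \<alpha> + \<gamma>) ` uminus ` S = uminus ` S" if "(\<lambda>\<alpha>. \<alpha> + \<gamma>) ` S = S" for \<gamma> and S :: "'a set"
  proof -
    have "(\<lambda>\<alpha>. \<alpha> + \<gamma>) ` uminus ` S = (\<lambda>\<alpha>. \<alpha> + \<gamma>) ` uminus ` (\<lambda>\<alpha>. \<alpha> + \<gamma>) ` S"
      using that by simp
    also have "\<dots> = uminus ` S" by (simp add: image_image)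
    finally show ?thesis .
  qed
  have "(\<lambda>\<alpha>. \<alpha> + \<gamma>) ` uminus ` S = uminus ` S \<longleftrightarrow> (\<lambda>\<alpha>. \<alpha> + \<gamma>) ` S = S" for \<gamma>
    using sub[of \<gamma> S] sub[of \<gamma> "uminus ` S"] by (auto simp: image_image)
  then show ?thesis by (simp add: inv_group_def)
qed

text \<open>Multiplication by t is injective and commutes with multiplication by b.\<close>

lemma mult_ring_scale: "t \<noteq> 0 \<Longrightarrow> mult_ring ((\<lambda>x. t * x) ` I) = mult_ring I"
proof -
  assume t: "t \<noteq> 0"
  have "(\<lambda>x. b * x) ` (\<lambda>x. t * x) ` I = (\<lambda>x. t * x) ` (\<lambda>x. b * x) ` I" for b
    by (simp add: image_image mult.left_commute)
  then show ?thesis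
    using t by (simp add: mult_ring_def inj_image_subset_iff inj_on_def)
qed

lemma mult_ideal_scale: "t \<noteq> 0 \<Longrightarrow> mult_ideal ((\<lambda>x. t * x) ` I) = mult_ideal I"
proof -
  assume t: "t \<noteq> 0"
  have "(\<lambda>x. b * x) ` (\<lambda>x. t * x) ` I = (\<lambda>x. t * x) ` (\<lambda>x. b * x) ` I" for b
    by (simp add: image_image mult.left_commute)
  then show ?thesis
    using t by (simp add: mult_ideal_def psubset_eq inj_image_subset_iff inj_image_eq_iff inj_on_def)
qed

context galois_defect
begin

text \<open>The generating set is already a submodule, so the hull adds nothing;
  \<open>val_shift\<close> turns the inequality defining it into membership in -v(a - K).\<close>

lemma I_diff_eq:
  assumes a: "a \<notin> K"
  shows "I_diff v a K = val_module v (uminus ` val_diff v a K)"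
proof -
  define B where "B = {b. b = 0 \<or> (\<exists>c\<in>K. v b \<ge> - v (a - c))}"
  have B: "B = {b. \<exists>c\<in>K. vge (- v (a - c)) b}"
    using K_zero by (auto simp: B_def vge_def)
  have val_ring: "val_ring v = {x. vge 0 x}" by (simp add: val_ring_def vge_def)
  interpret LL: field "LL :: 'l ring" by (rule LL_field)
  have "val_submodule v B"
    unfolding val_submodule_def
  proof (intro conjI ballI)
    show "additive_subgroup B LL"
    proof (rule additive_subgroup.intro, rule LL.add.subgroupI)
      fix x y assume "x \<in> B" "y \<in> B"
      then obtain c d where cd: "c \<in> K" "d \<in> K" "vge (- v (a - c)) x" "vge (- v (a - d)) y"
        by (auto simp: B)
      \<comment> \<open>The better of the two approximations bounds both x and y.\<close>
      define e where "e = (if v (a - c) \<le> v (a - d) then d else c)"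
      have "vge (- v (a - e)) x" "vge (- v (a - e)) y"
        using cd(3,4) by (auto simp: vge_def e_def intro: order_trans[rotated] le_imp_neg_le)
      then have "vge (- v (a - e)) (x + y)" by (rule vge_add)
      moreover have "e \<in> K" using cd by (simp add: e_def)
      ultimately show "x \<oplus>\<^bsub>LL\<^esub> y \<in> B" by (auto simp: B)
    next
      have "0 \<in> B" by (simp add: B_def)
      then show "B \<noteq> {}" by blast
    next
      fix x assume "x \<in> B"
      then show "\<ominus>\<^bsub>LL\<^esub> x \<in> B" by (simp add: B)
    qed simp
    fix r x assume "r \<in> val_ring v" "x \<in> B"
    then obtain c where "c \<in> K" "vge 0 r" "vge (- v (a - c)) x" by (auto simp: B val_ring)
    moreover from this have "vge (0 + - v (a - c)) (r * x)" by (intro vge_mult)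
    ultimately show "r * x \<in> B" by (auto simp: B)
  qed
  then have "I_diff v a K = B" unfolding I_diff_def B_def by (rule hull_same)
  also have "B = val_module v (uminus ` val_diff v a K)"
  proof -
    have "(\<exists>c\<in>K. - v (a - c) \<le> v b) \<longleftrightarrow> v b \<in> uminus ` val_diff v a K" if b: "b \<noteq> 0" for b
    proof
      assume "\<exists>c\<in>K. - v (a - c) \<le> v b"
      then obtain c where c: "c \<in> K" "v (inverse b) \<le> v (a - c)"
        using b by (auto simp: val_inverse minus_le_iff)
      obtain c' where "c' \<in> K" "v (a - c') = - v b"
        using val_shift[OF a c(1) _ c(2)] b val_inverse[OF b] by auto
      then show "v b \<in> uminus ` val_diff v a K"
        by (auto simp: val_diff_def image_image intro!: image_eqI[of _ _ c'])
    qed (auto simp: val_diff_def)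
    then show ?thesis by (auto simp: B_def val_module_def)
  qed
  finally show ?thesis .
qed

end

theorem theorem4p1:
  fixes K :: "'l::field set"
    and v :: "'l \<Rightarrow> 'g::linordered_ab_group_add"
    and p :: nat
  assumes "ring_char (residue_field v K) = p" and "p > 0"
    and "galois_defect_extension p K v"
  shows
    "(\<forall>\<sigma>. gal_generator K \<sigma> \<longrightarrow>
        final_segment_of (Sigma_set v \<sigma>) {\<alpha> \<in> value_group v K. 0 < \<alpha>}) \<and>
     (\<forall>\<sigma> \<tau>. gal_generator K \<sigma> \<and> gal_generator K \<tau> \<longrightarrow> Sigma_set v \<sigma> = Sigma_set v \<tau>) \<and>
     (\<forall>a \<sigma>. a \<notin> K \<and> gal_generator K \<sigma> \<longrightarrow>
        Sigma_ext v K = (\<lambda>\<alpha>. v (\<sigma> a - a) + \<alpha>) ` uminus ` val_diff v a K \<and>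
        I_ext v K = (\<lambda>x. (\<sigma> a - a) * x) ` I_diff v a K \<and>
        H_ext v K = H_diff v a K \<and>
        O_ext v K = O_diff v a K \<and>
        M_ext v K = M_diff v a K) \<and>
     (\<forall>a. a \<notin> K \<longrightarrow>
        H_ext v K = inv_group v (val_diff v a K) \<and>
        inv_group v (val_diff v a K) = inv_group v (uminus ` val_diff v a K))"
proof -
  have p: "Factorial_Ring.prime p" and gal: "galois_extension p K" and kv: "krull_valuation v"
    and defect: "unique_extension v K" "value_group v UNIV = value_group v K"
      "residue_field v UNIV = residue_field v K"
    using assms(3) by (simp_all add: galois_defect_extension_def)
  interpret galois_prime K p using gal p by unfold_locales
  interpret krull_valuation v by (rule kv)
  have intro_auto: "galois_defect K p \<sigma> v" if "\<sigma> \<in> carrier (gal K)" "\<sigma> \<noteq> id" for \<sigma>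
    using that defect by unfold_locales
  have intro: "galois_defect K p \<sigma> v" if "gal_generator K \<sigma>" for \<sigma>
    using intro_auto gal_generator_ne_id[OF that] that by (simp add: gal_generator_def)
  have indep: "Sigma_set v \<sigma> = Sigma_set v \<tau>" if "gal_generator K \<sigma>" "gal_generator K \<tau>" for \<sigma> \<tau>
    using galois_defect_auto_eq[OF intro intro] that by blast
  \<comment> \<open>Independence of the generator gives the definite description its unique
    value.\<close>
  then have Sigma_ext: "Sigma_ext v K = Sigma_set v \<sigma>" if "gal_generator K \<sigma>" for \<sigma>
    unfolding Sigma_ext_def using that by (intro the_equality) blast+
  have I_ext: "I_ext v K = val_module v (Sigma_ext v K)" by (simp add: I_ext_def val_module_def)
  have part2: "Sigma_ext v K = (\<lambda>\<alpha>. v (\<sigma> a - a) + \<alpha>) ` uminus ` val_diff v a K \<and>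
      I_ext v K = (\<lambda>x. (\<sigma> a - a) * x) ` I_diff v a K \<and> H_ext v K = H_diff v a K \<and>
      O_ext v K = O_diff v a K \<and> M_ext v K = M_diff v a K"
    if a: "a \<notin> K" and gen: "gal_generator K \<sigma>" for a \<sigma>
  proof -
    interpret galois_defect K p \<sigma> v by (rule intro[OF gen])
    interpret galois_defect_element K p \<sigma> v a using a by unfold_locales
    have t: "\<sigma> a - a \<noteq> 0" using a by (simp add: sigma_eq_self_iff)
    have S: "Sigma_ext v K = (\<lambda>\<alpha>. v (\<sigma> a - a) + \<alpha>) ` uminus ` val_diff v a K"
      using Sigma_ext[OF gen] Sigma_set_conv_val_diff by simp
    have I: "I_ext v K = (\<lambda>x. (\<sigma> a - a) * x) ` I_diff v a K"
      unfolding I_ext I_diff_eq[OF a] S by (rule val_module_translate[OF t])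
    have O: "O_ext v K = O_diff v a K"
      unfolding O_ext_def O_diff_def I by (rule mult_ring_scale[OF t])
    have M: "M_ext v K = M_diff v a K"
      unfolding M_ext_def M_diff_def I by (rule mult_ideal_scale[OF t])
    show ?thesis using S I O M by (simp add: H_ext_def H_diff_def)
  qed
  have part3: "H_ext v K = inv_group v (val_diff v a K)" if a: "a \<notin> K" for a
  proof -
    \<comment> \<open>The claim mentions no automorphism: one moving a exists because K is the fixed
      field, and being nontrivial it is a generator.\<close>
    obtain \<sigma> where \<sigma>: "\<sigma> \<in> carrier (gal K)" "\<sigma> \<noteq> id" using fixed_gal[of a] a by force
    interpret galois_defect K p \<sigma> v by (rule intro_auto[OF \<sigma>])
    have "uminus ` val_diff v a K \<subseteq> value_group v UNIV"
    proof
      fix \<gamma> assume "\<gamma> \<in> uminus ` val_diff v a K"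
      then obtain c where c: "c \<in> K" "\<gamma> = - v (a - c)" by (auto simp: val_diff_def)
      then have ne: "a - c \<noteq> 0" using a by auto
      then have "\<gamma> = v (inverse (a - c))" using c(2) by (simp add: val_inverse)
      then show "\<gamma> \<in> value_group v UNIV" using ne by (auto simp: value_group_def)
    qed
    then have "H_diff v a K = inv_group v (uminus ` val_diff v a K)"
      unfolding H_diff_def O_diff_def I_diff_eq[OF a] by (rule unit_values_mult_ring_val_module)
    then show ?thesis using part2[OF a gal_generator_sigma] by (simp add: inv_group_uminus)
  qed
  have final: "final_segment_of (Sigma_set v \<sigma>) {\<alpha> \<in> value_group v K. 0 < \<alpha>}"
    if "gal_generator K \<sigma>" for \<sigma>
    using galois_defect.final_segment_Sigma_set[OF intro[OF that]] .
  show ?thesis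
  proof (intro conjI; intro allI impI)
    fix \<sigma> \<tau> assume "gal_generator K \<sigma> \<and> gal_generator K \<tau>"
    then show "Sigma_set v \<sigma> = Sigma_set v \<tau>" by (elim conjE) (rule indep)
  next
    fix a \<sigma> assume "a \<notin> K \<and> gal_generator K \<sigma>"
    then show "Sigma_ext v K = (\<lambda>\<alpha>. v (\<sigma> a - a) + \<alpha>) ` uminus ` val_diff v a K \<and>
        I_ext v K = (\<lambda>x. (\<sigma> a - a) * x) ` I_diff v a K \<and> H_ext v K = H_diff v a K \<and>
        O_ext v K = O_diff v a K \<and> M_ext v K = M_diff v a K"
      by (intro part2) simp_all
  qed (simp_all only: final part3 inv_group_uminus simp_thms)
qed

end
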